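(* There is a polynomial time approximation scheme for the joint cache partition and job assignment problem when the jobs have a correlative single load and minimal cache demand: for every fixed $\epsilon>0$ there is a polynomial-time algorithm that, given such an instance with $c$ cores and cache $K$, returns a cache partition using at most $K$ cache and an assignment of the jobs to the $c$ cores with makespan at most $(1+\epsilon)$ times the minimum makespan achievable with $c$ cores and $K$ cache.
   Context: Single load minimal cache demand problem: each job $j$ has a load $a_j>0$ and a minimal cache demand $x_j\ge0$. A solution is a cache partition $p$ giving $p(i)\ge0$ cache to each of the $c$ cores with $\sum_ip(i)\le K$, and an assignment $S$ of jobs to cores such that $p(S(j))\ge x_j$ for every job $j$; the makespan is the maximum over cores of the total load of the jobs on it. The instance is correlative if for any two jobs $j,j'$ with $x_j>0$ and $x_{j'}>0$ we have $a_j\le a_{j'}\iff x_j\le x_{j'}$. *)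

theory Defs
  imports Complex_Main "HOL-Library.Log_Nat" "HOL-Computational_Algebra.Polynomial"
begin

section \<open>Polynomial-time algorithms\<close>

text \<open>
  The model of computation is a first-order, call-by-value functional language over
  binary trees with integer leaves, under the logarithmic cost criterion: the cost of a run
  accounts for the number of evaluation steps and for the bit size of every value
  that is read or produced.  A run of cost \<open>t\<close> thus performs at most \<open>t\<close> steps, and all values
  occurring in it have size at most \<open>t\<close>.  Every primitive is computable in time polynomial in the
  bit size of its arguments, so polynomial cost in this model is the same as polynomial time on
  Turing machines.
\<close>

datatype val = Num int | Node val val

fun vsize :: "val \<Rightarrow> nat" where
  "vsize (Num z) = 1 + floorlog 2 (nat \<bar>z\<bar>)"
| "vsize (Node u v) = 1 + vsize u + vsize v"

datatype unop = Fst | Snd | IsNode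

datatype binop = MkNode | Add | Sub | Mul | Div | Leq

text \<open>Variables are de Bruijn indices into the environment, functions are indices into the program.\<close>

datatype expr =
    Var nat
  | Const int
  | Unop unop expr
  | Binop binop expr expr
  | Cond expr expr expr
  | Bind expr expr
  | Call nat "expr list"

type_synonym program = "expr list"

text \<open>Ill-typed applications of primitives yield \<open>Num 0\<close>.\<close>

fun unop_val :: "unop \<Rightarrow> val \<Rightarrow> val" where
  "unop_val Fst (Node u v) = u"
| "unop_val Snd (Node u v) = v"
| "unop_val IsNode (Node u v) = Num 1"
| "unop_val _ _ = Num 0"

fun binop_val :: "binop \<Rightarrow> val \<Rightarrow> val \<Rightarrow> val" where
  "binop_val MkNode u v = Node u v"
| "binop_val Add (Num a) (Num b) = Num (a + b)"
| "binop_val Sub (Num a) (Num b) = Num (a - b)"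
| "binop_val Mul (Num a) (Num b) = Num (a * b)"
| "binop_val Div (Num a) (Num b) = Num (a div b)"
| "binop_val Leq (Num a) (Num b) = Num (if a \<le> b then 1 else 0)"
| "binop_val _ _ _ = Num 0"

text \<open>\<open>eval P \<rho> e v t\<close>: in environment \<open>\<rho>\<close>, \<open>e\<close> evaluates to \<open>v\<close> at cost \<open>t\<close>.\<close>

inductive
  eval :: "program \<Rightarrow> val list \<Rightarrow> expr \<Rightarrow> val \<Rightarrow> nat \<Rightarrow> bool" and
  evals :: "program \<Rightarrow> val list \<Rightarrow> expr list \<Rightarrow> val list \<Rightarrow> nat \<Rightarrow> bool"
  for P :: program where
  Var: "i < length \<rho> \<Longrightarrow> eval P \<rho> (Var i) (\<rho> ! i) (1 + vsize (\<rho> ! i))"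
| Const: "eval P \<rho> (Const z) (Num z) (1 + vsize (Num z))"
| Unop: "eval P \<rho> e u t \<Longrightarrow> v = unop_val f u \<Longrightarrow>
    eval P \<rho> (Unop f e) v (1 + vsize v + t)"
| Binop: "eval P \<rho> e\<^sub>1 u\<^sub>1 t\<^sub>1 \<Longrightarrow> eval P \<rho> e\<^sub>2 u\<^sub>2 t\<^sub>2 \<Longrightarrow> v = binop_val f u\<^sub>1 u\<^sub>2 \<Longrightarrow>
    eval P \<rho> (Binop f e\<^sub>1 e\<^sub>2) v (1 + vsize v + t\<^sub>1 + t\<^sub>2)"
| Cond_true: "eval P \<rho> b u t \<Longrightarrow> u \<noteq> Num 0 \<Longrightarrow> eval P \<rho> e\<^sub>1 v t' \<Longrightarrow>
    eval P \<rho> (Cond b e\<^sub>1 e\<^sub>2) v (1 + t + t')"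
| Cond_false: "eval P \<rho> b (Num 0) t \<Longrightarrow> eval P \<rho> e\<^sub>2 v t' \<Longrightarrow>
    eval P \<rho> (Cond b e\<^sub>1 e\<^sub>2) v (1 + t + t')"
| Bind: "eval P \<rho> e\<^sub>1 u t \<Longrightarrow> eval P (u # \<rho>) e\<^sub>2 v t' \<Longrightarrow>
    eval P \<rho> (Bind e\<^sub>1 e\<^sub>2) v (1 + t + t')"
| Call: "f < length P \<Longrightarrow> evals P \<rho> es us t \<Longrightarrow> eval P us (P ! f) v t' \<Longrightarrow>
    eval P \<rho> (Call f es) v (1 + t + t')"
| Args_Nil: "evals P \<rho> [] [] 0"
| Args_Cons: "eval P \<rho> e v t \<Longrightarrow> evals P \<rho> es vs t' \<Longrightarrow> evals P \<rho> (e # es) (v # vs) (t + t')"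

definition runs :: "program \<Rightarrow> val \<Rightarrow> val \<Rightarrow> nat \<Rightarrow> bool" where
  "runs P x y t \<longleftrightarrow> eval P [x] (Call 0 [Var 0]) y t"

definition returns :: "program \<Rightarrow> val \<Rightarrow> val \<Rightarrow> bool" where
  "returns P x y \<longleftrightarrow> (\<exists>t. runs P x y t)"

definition poly_time_on :: "program \<Rightarrow> val set \<Rightarrow> bool" where
  "poly_time_on P X \<longleftrightarrow>
    (\<exists>q :: nat poly. \<forall>x\<in>X. \<exists>y t. runs P x y t \<and> t \<le> poly q (vsize x))"

text \<open>Programs are deterministic, so \<^const>\<open>returns\<close> singles out the only output.\<close>

inductive_cases eval_elims:
  "eval P \<rho> (Var i) v t" "eval P \<rho> (Const z) v t" "eval P \<rho> (Unop f e) v t"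
  "eval P \<rho> (Binop f e\<^sub>1 e\<^sub>2) v t" "eval P \<rho> (Cond b e\<^sub>1 e\<^sub>2) v t"
  "eval P \<rho> (Bind e\<^sub>1 e\<^sub>2) v t" "eval P \<rho> (Call f es) v t"
  "evals P \<rho> [] vs t" "evals P \<rho> (e # es) vs t"

lemma eval_deterministic:
  "eval P \<rho> e v t \<Longrightarrow> eval P \<rho> e v' t' \<Longrightarrow> v = v' \<and> t = t'"
  "evals P \<rho> es vs s \<Longrightarrow> evals P \<rho> es vs' s' \<Longrightarrow> vs = vs' \<and> s = s'"
  by (induction arbitrary: v' t' and vs' s' rule: eval_evals.inducts)
    (erule eval_elims; metis plus_1_eq_Suc add_Suc vsize.simps(1))+

lemma runs_deterministic: "runs P x y t \<Longrightarrow> runs P x y' t' \<Longrightarrow> y = y' \<and> t = t'"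
  unfolding runs_def by (rule eval_deterministic)


section \<open>Single load and minimal cache demand\<close>

text \<open>
  Jobs are the indices \<open>j < num_jobs I\<close> and cores the indices \<open>i < cores I\<close>.  An entry of
  \<open>jobs\<close> consists of the load and the minimal cache demand of a job.  The numbers in an instance
  are rational, so that it is a finite object; solutions range over real cache partitions.
\<close>

record problem =
  jobs :: "(rat \<times> rat) list"
  cores :: nat
  cache :: rat

definition num_jobs :: "problem \<Rightarrow> nat" where
  "num_jobs I = length (jobs I)"

definition load :: "problem \<Rightarrow> nat \<Rightarrow> real" where
  "load I j = of_rat (fst (jobs I ! j))"

definition demand :: "problem \<Rightarrow> nat \<Rightarrow> real" where
  "demand I j = of_rat (snd (jobs I ! j))"

definition wf_problem :: "problem \<Rightarrow> bool" where
  "wf_problem I \<longleftrightarrow> cores I \<ge> 1 \<and> cache I \<ge> 0 \<and>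
    (\<forall>j<num_jobs I. load I j > 0 \<and> demand I j \<ge> 0)"

definition correlative :: "problem \<Rightarrow> bool" where
  "correlative I \<longleftrightarrow> (\<forall>j<num_jobs I. \<forall>j'<num_jobs I. demand I j > 0 \<longrightarrow> demand I j' > 0 \<longrightarrow>
    (load I j \<le> load I j' \<longleftrightarrow> demand I j \<le> demand I j'))"

definition is_solution :: "problem \<Rightarrow> (nat \<Rightarrow> real) \<Rightarrow> (nat \<Rightarrow> nat) \<Rightarrow> bool" where
  "is_solution I p S \<longleftrightarrow>
    (\<forall>i<cores I. p i \<ge> 0) \<and> (\<Sum>i<cores I. p i) \<le> of_rat (cache I) \<and>
    (\<forall>j<num_jobs I. S j < cores I \<and> p (S j) \<ge> demand I j)"

definition makespan :: "problem \<Rightarrow> (nat \<Rightarrow> nat) \<Rightarrow> real" where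
  "makespan I S = (MAX i\<in>{..<cores I}. \<Sum>j | j < num_jobs I \<and> S j = i. load I j)"

definition solvable :: "problem \<Rightarrow> bool" where
  "solvable I \<longleftrightarrow> (\<exists>p S. is_solution I p S)"

definition makespans :: "problem \<Rightarrow> real set" where
  "makespans I = {makespan I S | p S. is_solution I p S}"

definition opt_makespan :: "problem \<Rightarrow> real" where
  "opt_makespan I = Min (makespans I)"

text \<open>The minimum is well-defined for solvable instances.\<close>

lemma finite_makespans: "finite (makespans I)"
proof -
  let ?n = "num_jobs I" and ?c = "cores I"
  let ?f = "\<lambda>xs. makespan I (\<lambda>j. xs ! j)"
  have "makespan I S = ?f (map S [0..<?n])" for S
    unfolding makespan_def
    by (intro arg_cong[where f = Max] image_cong refl sum.cong) auto
  moreover have "map S [0..<?n] \<in> {xs. set xs \<subseteq> {..<?c} \<and> length xs = ?n}"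
    if "is_solution I p S" for p S
    using that by (auto simp: is_solution_def)
  ultimately have "makespans I \<subseteq> ?f ` {xs. set xs \<subseteq> {..<?c} \<and> length xs = ?n}"
    unfolding makespans_def by blast
  then show ?thesis
    by (rule finite_subset) (simp add: finite_lists_length_eq)
qed

lemma makespans_nonempty: "solvable I \<longleftrightarrow> makespans I \<noteq> {}"
  by (auto simp: solvable_def makespans_def)


section \<open>Encodings\<close>

definition encode_list :: "('a \<Rightarrow> val) \<Rightarrow> 'a list \<Rightarrow> val" where
  "encode_list f xs = foldr (\<lambda>x. Node (f x)) xs (Num 0)"

definition encode_rat :: "rat \<Rightarrow> val" where
  "encode_rat r = (case quotient_of r of (a, b) \<Rightarrow> Node (Num a) (Num b))"

definition encode_problem :: "problem \<Rightarrow> val" where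
  "encode_problem I =
    Node (encode_list (\<lambda>(a, x). Node (encode_rat a) (encode_rat x)) (jobs I))
      (Node (Num (int (cores I))) (encode_rat (cache I)))"

definition encode_solution :: "rat list \<Rightarrow> nat list \<Rightarrow> val" where
  "encode_solution ps ss = Node (encode_list encode_rat ps) (encode_list (\<lambda>i. Num (int i)) ss)"

text \<open>
  The number of cores is written in binary, so it may be exponential in the size of the input.
  The list representing a cache partition may therefore be shorter than the number of cores;
  cores beyond its end receive no cache.
\<close>

definition partition_of :: "rat list \<Rightarrow> nat \<Rightarrow> real" where
  "partition_of ps i = (if i < length ps then of_rat (ps ! i) else 0)"

definition assignment_of :: "nat list \<Rightarrow> nat \<Rightarrow> nat" where
  "assignment_of ss j = ss ! j"

end

theory Submission
  imports Defs
begin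

text \<open>
  Fix \<open>m \<ge> 13 / \<epsilon>\<close>.  For a guess \<open>T\<close> of the makespan, call a job small if its load is below
  \<open>T / m\<close>.  Small jobs are taken by decreasing demand and glued together to bundles of load at least
  \<open>T / m\<close>.  Running through the cores by decreasing cache and refilling the space that the
  small jobs occupy in an optimal solution with these bundles overloads each core by at most \<open>2 T / m\<close>.
  Afterwards each core holds at most \<open>m + 3\<close> items, so that rounding loads to multiples of
  \<open>T / m\<^sup>2\<close> is affordable and leaves a constant number \<open>L\<close> of possible core loads.  A dynamic program
  inserts the items by decreasing demand; then the cache of a core is the demand of its first
  item, and among the partial solutions that agree on the number of cores of each load only
  the cheapest one matters.  These are at most \<open>(n + 1)\<^bsup>L + 1\<^esup>\<close> many.  Finally, all multiples of
  \<open>max a\<^sub>j / m\<close> up to \<open>n max a\<^sub>j\<close> are tried as guesses \<open>T\<close>.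

  The program is never written down.  Polynomial-time computability of functions
  between encodable types is closed under composition, case distinction and folding over a list,
  provided that the intermediate states of the fold have polynomial size, and the algorithm is
  a composition of such functions.
\<close>

section \<open>A calculus of polynomial-time functions\<close>

text \<open>Rounding up costs up to one unit \<open>u = T / m^2\<close> per item. For a load of at
  least \<open>m\<close> units this is a fraction \<open>1 / m\<close>, but many tiny jobs would
  ruin the estimate; hence the bundles. A bundle needs the cache of its most demanding job, so
  bundling must follow the demand order, and the overload \<open>2 T / m\<close> is the largest load
  of the one bundle that sticks out of the space of a core. The constant 13: a core ends with at
  most \<open>m^2 + 3 m + 3\<close> units where the guess allows \<open>m^2\<close>, and the spacing
  of the guesses costs a factor \<open>(m + 1) / m\<close>. The product is
  \<open>1 + 4 / m + 6 / m^2 + 3 / m^3\<close>, at most \<open>1 + 13 / m\<close>. Sums are taken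
  over integers only: loads and demands are multiplied by a common denominator, loads also by
  \<open>m^3\<close>, so that guess, threshold and unit are all integers. As the number of cores is
  written in binary, the algorithm works with \<open>min c n\<close> cores; no solution uses more
  than one core per job. The output comes from the first guess that yields an affordable table
  entry. Success need not be monotone in the guess: any entry found at a smaller guess obeys an even
  better bound.\<close>

class encodable =
  fixes enc :: "'a \<Rightarrow> val"

instantiation int :: encodable
begin
definition enc_int :: "int \<Rightarrow> val" where "enc_int = Num"
instance ..
end

instantiation nat :: encodable
begin
definition enc_nat :: "nat \<Rightarrow> val" where "enc_nat n = Num (int n)"
instance ..
end

instantiation bool :: encodable
begin
definition enc_bool :: "bool \<Rightarrow> val" where "enc_bool b = Num (if b then 1 else 0)"
instance ..
end

instantiation rat :: encodable
begin
definition enc_rat :: "rat \<Rightarrow> val" where "enc_rat = encode_rat"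
instance ..
end

instantiation prod :: (encodable, encodable) encodable
begin
definition enc_prod :: "'a \<times> 'b \<Rightarrow> val" where "enc_prod p = Node (enc (fst p)) (enc (snd p))"
instance ..
end

instantiation list :: (encodable) encodable
begin
definition enc_list :: "'a list \<Rightarrow> val" where "enc_list = encode_list enc"
instance ..
end

lemma enc_simps [simp]:
  "enc (a, b) = Node (enc a) (enc b)"
  "enc ([] :: 'c::encodable list) = Num 0"
  "enc (c # cs) = Node (enc c) (enc cs)"
  by (simp_all add: enc_prod_def enc_list_def encode_list_def)

abbreviation sz :: "'a::encodable \<Rightarrow> nat" where
  "sz x \<equiv> vsize (enc x)"

section \<open>Linking programs\<close>

text \<open>Calls address functions by absolute position, so the calls of a program placed behind
  \<open>n\<close> other functions must be relocated by \<open>n\<close>.\<close>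

fun shift :: "nat \<Rightarrow> expr \<Rightarrow> expr" where
  "shift n (Var i) = Var i"
| "shift n (Const z) = Const z"
| "shift n (Unop f e) = Unop f (shift n e)"
| "shift n (Binop f e\<^sub>1 e\<^sub>2) = Binop f (shift n e\<^sub>1) (shift n e\<^sub>2)"
| "shift n (Cond b e\<^sub>1 e\<^sub>2) = Cond (shift n b) (shift n e\<^sub>1) (shift n e\<^sub>2)"
| "shift n (Bind e\<^sub>1 e\<^sub>2) = Bind (shift n e\<^sub>1) (shift n e\<^sub>2)"
| "shift n (Call f es) = Call (n + f) (map (shift n) es)"

lemmas eval_intros = eval_evals.intros[simplified]

lemma eval_shift:
  "eval P \<rho> e v t \<Longrightarrow> eval (Q @ map (shift (length Q)) P) \<rho> (shift (length Q) e) v t"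
  "evals P \<rho> es vs s \<Longrightarrow>
    evals (Q @ map (shift (length Q)) P) \<rho> (map (shift (length Q)) es) vs s"
proof (induction rule: eval_evals.inducts)
  case (Call f \<rho> es us t v t')
  then show ?case
    unfolding shift.simps by (intro eval_evals.Call) (auto simp: nth_append)
qed (auto intro: eval_intros)

lemma eval_append_program:
  "eval P \<rho> e v t \<Longrightarrow> eval (P @ Q) \<rho> e v t"
  "evals P \<rho> es vs s \<Longrightarrow> evals (P @ Q) \<rho> es vs s"
proof (induction rule: eval_evals.inducts)
  case (Call f \<rho> es us t v t')
  then show ?case
    by (intro eval_evals.Call) (auto simp: nth_append)
qed (auto intro: eval_intros)

text \<open>Variables are counted from the front, so values at the far end of the environment are
  never reached. An expression written for one value can therefore run below a
  \<open>Bind\<close>.\<close>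

lemma eval_append_env:
  "eval P \<rho> e v t \<Longrightarrow> eval P (\<rho> @ \<sigma>) e v t"
  "evals P \<rho> es vs s \<Longrightarrow> evals P (\<rho> @ \<sigma>) es vs s"
proof (induction rule: eval_evals.inducts)
  case (Var i \<rho>)
  then have "eval P (\<rho> @ \<sigma>) (Var i) ((\<rho> @ \<sigma>) ! i) (1 + vsize ((\<rho> @ \<sigma>) ! i))"
    by (intro eval_evals.Var) simp
  then show ?case using Var by (simp add: nth_append)
qed (auto intro: eval_intros)

lemma vsize_le_cost:
  "eval P \<rho> e v t \<Longrightarrow> vsize v \<le> t"
  "evals P \<rho> es vs s \<Longrightarrow> True"
  by (induction rule: eval_evals.inducts) auto

section \<open>Evaluation with an upper bound on the cost\<close>

text \<open>Exact costs do not compose conveniently; a bound may be enlarged at will, in particular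
  to one that depends on input sizes only.\<close>

definition evalb :: "program \<Rightarrow> val list \<Rightarrow> expr \<Rightarrow> val \<Rightarrow> nat \<Rightarrow> bool" where
  "evalb P \<rho> e v T \<longleftrightarrow> (\<exists>t\<le>T. eval P \<rho> e v t)"

lemma evalb_mono: "evalb P \<rho> e v T \<Longrightarrow> T \<le> T' \<Longrightarrow> evalb P \<rho> e v T'"
  unfolding evalb_def using le_trans by blast

lemma evalb_vsize: "evalb P \<rho> e v T \<Longrightarrow> vsize v \<le> T"
  unfolding evalb_def using vsize_le_cost(1) le_trans by blast

lemma evalb_append_env: "evalb P \<rho> e v T \<Longrightarrow> evalb P (\<rho> @ \<sigma>) e v T"
  unfolding evalb_def using eval_append_env by blast

lemma evalb_Var: "i < length \<rho> \<Longrightarrow> v = \<rho> ! i \<Longrightarrow> evalb P \<rho> (Var i) v (1 + vsize v)"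
  unfolding evalb_def using eval_evals.Var by blast

lemma evalb_Const: "evalb P \<rho> (Const z) (Num z) (1 + vsize (Num z))"
  unfolding evalb_def using eval_evals.Const by blast

lemma evalb_Unop:
  "evalb P \<rho> e u T \<Longrightarrow> v = unop_val f u \<Longrightarrow> evalb P \<rho> (Unop f e) v (1 + vsize v + T)"
  unfolding evalb_def by (meson add_le_mono eval_evals.Unop order_refl)

lemma evalb_Binop:
  "evalb P \<rho> e\<^sub>1 u\<^sub>1 T\<^sub>1 \<Longrightarrow> evalb P \<rho> e\<^sub>2 u\<^sub>2 T\<^sub>2 \<Longrightarrow> v = binop_val f u\<^sub>1 u\<^sub>2 \<Longrightarrow>
    evalb P \<rho> (Binop f e\<^sub>1 e\<^sub>2) v (1 + vsize v + T\<^sub>1 + T\<^sub>2)"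
  unfolding evalb_def by (meson add_le_mono eval_evals.Binop order_refl)

lemma evalb_Cond:
  assumes "evalb P \<rho> b u T" "u \<noteq> Num 0 \<Longrightarrow> evalb P \<rho> e\<^sub>1 v T'"
    "u = Num 0 \<Longrightarrow> evalb P \<rho> e\<^sub>2 v T'"
  shows "evalb P \<rho> (Cond b e\<^sub>1 e\<^sub>2) v (1 + T + T')"
proof (cases "u = Num 0")
  case True
  with assms obtain t t' where "eval P \<rho> b (Num 0) t" "t \<le> T" "eval P \<rho> e\<^sub>2 v t'" "t' \<le> T'"
    unfolding evalb_def by blast
  then show ?thesis
    unfolding evalb_def by (meson add_le_mono eval_evals.Cond_false order_refl)
next
  case False
  with assms obtain t t' where "eval P \<rho> b u t" "t \<le> T" "eval P \<rho> e\<^sub>1 v t'" "t' \<le> T'"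
    unfolding evalb_def by blast
  then show ?thesis
    using False unfolding evalb_def by (meson add_le_mono eval_evals.Cond_true order_refl)
qed

lemma evalb_Bind:
  "evalb P \<rho> e\<^sub>1 u T \<Longrightarrow> evalb P (u # \<rho>) e\<^sub>2 v T' \<Longrightarrow> evalb P \<rho> (Bind e\<^sub>1 e\<^sub>2) v (1 + T + T')"
  unfolding evalb_def by (meson add_le_mono eval_evals.Bind order_refl)

lemma evalb_Call3:
  assumes "f < length P" "evalb P \<rho> e\<^sub>1 u\<^sub>1 T\<^sub>1" "evalb P \<rho> e\<^sub>2 u\<^sub>2 T\<^sub>2" "evalb P \<rho> e\<^sub>3 u\<^sub>3 T\<^sub>3"
    "evalb P [u\<^sub>1, u\<^sub>2, u\<^sub>3] (P ! f) v T"
  shows "evalb P \<rho> (Call f [e\<^sub>1, e\<^sub>2, e\<^sub>3]) v (1 + (T\<^sub>1 + (T\<^sub>2 + T\<^sub>3)) + T)"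
proof -
  obtain t\<^sub>1 t\<^sub>2 t\<^sub>3 t where t: "eval P \<rho> e\<^sub>1 u\<^sub>1 t\<^sub>1" "eval P \<rho> e\<^sub>2 u\<^sub>2 t\<^sub>2" "eval P \<rho> e\<^sub>3 u\<^sub>3 t\<^sub>3"
    "eval P [u\<^sub>1, u\<^sub>2, u\<^sub>3] (P ! f) v t" "t\<^sub>1 \<le> T\<^sub>1" "t\<^sub>2 \<le> T\<^sub>2" "t\<^sub>3 \<le> T\<^sub>3" "t \<le> T"
    using assms unfolding evalb_def by blast
  have "evals P \<rho> [e\<^sub>1, e\<^sub>2, e\<^sub>3] [u\<^sub>1, u\<^sub>2, u\<^sub>3] (t\<^sub>1 + (t\<^sub>2 + (t\<^sub>3 + 0)))"
    by (intro Args_Cons Args_Nil t)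
  from eval_evals.Call[OF assms(1) this t(4)] show ?thesis
    unfolding evalb_def using t(5-)
    by (intro exI[of _ "1 + (t\<^sub>1 + (t\<^sub>2 + (t\<^sub>3 + 0))) + t"]) simp
qed

section \<open>Polynomially bounded functions\<close>

lemma poly_mono_nat: "a \<le> b \<Longrightarrow> poly (q :: nat poly) a \<le> poly q b"
  by (induction q) (auto intro: add_mono mult_mono)

text \<open>Domination by a polynomial, rather than being one, lets bounds be written as ordinary
  functions and discharged by introduction rules.\<close>

definition pbound :: "(nat \<Rightarrow> nat) \<Rightarrow> bool" where
  "pbound g \<longleftrightarrow> (\<exists>q :: nat poly. \<forall>n. g n \<le> poly q n)"

named_theorems pbound_intros

lemma pbound_poly [pbound_intros]: "pbound (poly q)"
  unfolding pbound_def by blast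

lemma pbound_const [pbound_intros]: "pbound (\<lambda>n. c)"
  unfolding pbound_def by (rule exI[of _ "[:c:]"]) simp

lemma pbound_id [pbound_intros]: "pbound (\<lambda>n. n)"
  unfolding pbound_def by (rule exI[of _ "[:0, 1:]"]) simp

lemma pbound_add [pbound_intros]: "pbound g \<Longrightarrow> pbound h \<Longrightarrow> pbound (\<lambda>n. g n + h n)"
  unfolding pbound_def by (metis add_mono poly_add)

lemma pbound_Suc [pbound_intros]: "pbound g \<Longrightarrow> pbound (\<lambda>n. Suc (g n))"
  using pbound_add[OF pbound_const[of 1]] by simp

lemma pbound_mult [pbound_intros]: "pbound g \<Longrightarrow> pbound h \<Longrightarrow> pbound (\<lambda>n. g n * h n)"
  unfolding pbound_def by (metis mult_le_mono poly_mult)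

lemma pbound_power [pbound_intros]: "pbound g \<Longrightarrow> pbound (\<lambda>n. g n ^ k)"
  by (induction k) (auto intro: pbound_intros)

text \<open>Natural coefficients make polynomials monotone, so the outer bound may be applied to the
  inner one.\<close>

lemma pbound_compose: "pbound g \<Longrightarrow> pbound h \<Longrightarrow> pbound (\<lambda>n. g (h n))"
  unfolding pbound_def by (metis le_trans poly_mono_nat poly_pcompose)

lemmas pbound_poly_compose [pbound_intros] = pbound_compose[OF pbound_poly]

section \<open>Polynomial-time functions and their composition\<close>

definition computes ::
  "program \<Rightarrow> expr \<Rightarrow> nat poly \<Rightarrow> ('a::encodable \<Rightarrow> 'b::encodable) \<Rightarrow> bool" where
  "computes P e q f \<longleftrightarrow> (\<forall>x. evalb P [enc x] e (enc (f x)) (poly q (sz x)))"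

text \<open>The bound is required on every value of the type, so the algorithm has to be total and
  fast on unsolvable instances as well.\<close>

definition ptime :: "('a::encodable \<Rightarrow> 'b::encodable) \<Rightarrow> bool" where
  "ptime f \<longleftrightarrow> (\<exists>P e q. computes P e q f)"

named_theorems ptime_intros

lemma ptimeI:
  assumes "\<And>x. evalb P [enc x] e (enc (f x)) (B (sz x))" "pbound B"
  shows "ptime f"
  using assms unfolding ptime_def computes_def pbound_def by (meson evalb_mono)

lemma ptimeE:
  assumes "ptime f"
  obtains P e q where "computes P e q f"
  using assms unfolding ptime_def by blast

lemma computesD: "computes P e q f \<Longrightarrow> evalb P [enc x] e (enc (f x)) (poly q (sz x))"
  unfolding computes_def by blast

lemma computes_append: "computes P e q f \<Longrightarrow> computes (P @ Q) e q f"
  unfolding computes_def evalb_def using eval_append_program by blast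

lemma computes_shift:
  "computes P e q f \<Longrightarrow> computes (Q @ map (shift (length Q)) P) (shift (length Q) e) q f"
  unfolding computes_def evalb_def using eval_shift by blast

text \<open>The second program is appended to the first and relocated, so that one program serves
  both expressions.\<close>

lemma ptime_link:
  assumes "ptime f" "ptime g"
  obtains P e\<^sub>1 e\<^sub>2 q\<^sub>1 q\<^sub>2 where "computes P e\<^sub>1 q\<^sub>1 f" "computes P e\<^sub>2 q\<^sub>2 g"
  using assms unfolding ptime_def by (metis computes_append computes_shift)

lemma ptime_link3:
  assumes "ptime f" "ptime g" "ptime h"
  obtains P e\<^sub>1 e\<^sub>2 e\<^sub>3 q\<^sub>1 q\<^sub>2 q\<^sub>3
  where "computes P e\<^sub>1 q\<^sub>1 f" "computes P e\<^sub>2 q\<^sub>2 g" "computes P e\<^sub>3 q\<^sub>3 h"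
  using ptime_link[OF assms(1,2)] assms(3) unfolding ptime_def
  by (metis computes_append computes_shift)

text \<open>Producing a value costs at least its size, so every time bound is also an output size
  bound.\<close>

lemma ptime_size: assumes "ptime f" obtains B where "pbound B" "mono B" "\<And>x. sz (f x) \<le> B (sz x)"
  using assms
  by (metis computes_def evalb_vsize monoI pbound_poly poly_mono_nat ptimeE)

lemma ptime_id [ptime_intros]: "ptime (\<lambda>x. x)"
  by (rule ptimeI[of "[]" "Var 0" _ "\<lambda>n. 1 + n", OF evalb_Var])
    (auto intro: pbound_intros)

lemma ptime_const [ptime_intros]: "ptime (\<lambda>x :: 'a::encodable. c)"
proof -
  have "\<exists>e T. \<forall>\<rho>. evalb [] \<rho> e v T" for v
  proof (induction v)
    case (Num z)
    show ?case
      using evalb_Const[of "[]" _ z] by blast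
  next
    case (Node u v)
    then obtain e\<^sub>1 T\<^sub>1 e\<^sub>2 T\<^sub>2
      where "\<And>\<rho>. evalb [] \<rho> e\<^sub>1 u T\<^sub>1" "\<And>\<rho>. evalb [] \<rho> e\<^sub>2 v T\<^sub>2"
      by blast
    from evalb_Binop[OF this binop_val.simps(1)[symmetric]] show ?case
      by blast
  qed
  then obtain e T where "\<And>\<rho>. evalb [] \<rho> e (enc c) T"
    by blast
  then show ?thesis
    by (rule ptimeI) (intro pbound_intros)
qed

lemma ptime_compose:
  assumes "ptime f" "ptime g"
  shows "ptime (\<lambda>x. f (g x))"
proof -
  obtain P e\<^sub>1 e\<^sub>2 q\<^sub>1 q\<^sub>2 where c: "computes P e\<^sub>1 q\<^sub>1 f" "computes P e\<^sub>2 q\<^sub>2 g"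
    by (rule ptime_link[OF assms])
  show ?thesis
  proof (rule ptimeI)
    fix x
    have g: "evalb P [enc x] e\<^sub>2 (enc (g x)) (poly q\<^sub>2 (sz x))"
      by (rule computesD[OF c(2)])
    have "evalb P ([enc (g x)] @ [enc x]) e\<^sub>1 (enc (f (g x))) (poly q\<^sub>1 (sz (g x)))"
      by (intro evalb_append_env computesD[OF c(1)])
    then have "evalb P [enc (g x), enc x] e\<^sub>1 (enc (f (g x))) (poly q\<^sub>1 (poly q\<^sub>2 (sz x)))"
      using evalb_mono poly_mono_nat[OF evalb_vsize[OF g]] by fastforce
    from evalb_Bind[OF g this]
    show "evalb P [enc x] (Bind e\<^sub>2 e\<^sub>1) (enc (f (g x)))
      ((\<lambda>n. 1 + poly q\<^sub>2 n + poly q\<^sub>1 (poly q\<^sub>2 n)) (sz x))"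
      by simp
  qed (intro pbound_intros)
qed

text \<open>Programs see encodings only. Conversions that leave the encoding unchanged, such as
  \<open>int\<close> and \<open>quotient_of\<close>, are thus identities.\<close>

lemma ptime_cast: "ptime f \<Longrightarrow> (\<And>x. enc (h x) = enc (f x)) \<Longrightarrow> ptime h"
  unfolding ptime_def computes_def by simp

lemma ptime_unop:
  assumes "ptime f" "\<And>x. enc (h x) = unop_val u (enc (f x))"
  shows "ptime h"
proof -
  obtain P e q where c: "computes P e q f"
    by (rule ptimeE[OF assms(1)])
  have le: "vsize (unop_val u v) \<le> 1 + vsize v" for v
    by (cases "(u, v)" rule: unop_val.cases) (auto simp: floorlog_def)
  show ?thesis
  proof (rule ptimeI)
    fix x
    have f: "evalb P [enc x] e (enc (f x)) (poly q (sz x))"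
      by (rule computesD[OF c])
    have "sz (h x) \<le> 1 + poly q (sz x)"
      using le[of "enc (f x)"] evalb_vsize[OF f] by (simp add: assms(2))
    then show "evalb P [enc x] (Unop u e) (enc (h x))
      ((\<lambda>n. 1 + (1 + poly q n) + poly q n) (sz x))"
      by (intro evalb_mono[OF evalb_Unop[OF f assms(2)]]) simp
  qed (intro pbound_intros)
qed

section \<open>Bit sizes under arithmetic\<close>

lemma floorlog_le: "floorlog 2 n \<le> k \<longleftrightarrow> n < 2 ^ k"
  using floorlog_le_iff[of 2 n k] by simp

lemma less_power_floorlog: "n < 2 ^ floorlog 2 n"
  using floorlog_le[of n "floorlog 2 n"] by simp

lemma vsize_Num_mono: "\<bar>a\<bar> \<le> \<bar>b\<bar> \<Longrightarrow> vsize (Num a) \<le> vsize (Num b)"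
  by (simp add: floorlog_mono nat_mono)

lemma vsize_add: "vsize (Num (a + b)) \<le> vsize (Num a) + vsize (Num b)"
proof -
  let ?f = "\<lambda>z. floorlog 2 (nat \<bar>z\<bar>)"
  have "nat \<bar>a + b\<bar> \<le> nat \<bar>a\<bar> + nat \<bar>b\<bar>"
    by linarith
  also have "\<dots> < 2 ^ ?f a + 2 ^ ?f b"
    by (intro add_strict_mono less_power_floorlog)
  also have "\<dots> \<le> 2 ^ (?f a + ?f b) + (2 ^ (?f a + ?f b) :: nat)"
    by (intro add_mono power_increasing) auto
  also have "\<dots> = 2 ^ (?f a + ?f b + 1)"
    by simp
  finally show ?thesis
    unfolding floorlog_le[symmetric] by simp
qed

lemma vsize_diff: "vsize (Num (a - b)) \<le> vsize (Num a) + vsize (Num b)"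
  using vsize_add[of a "- b"] by simp

lemma vsize_mult: "vsize (Num (a * b)) \<le> vsize (Num a) + vsize (Num b)"
proof -
  let ?f = "\<lambda>z. floorlog 2 (nat \<bar>z\<bar>)"
  have "nat \<bar>a * b\<bar> = nat \<bar>a\<bar> * nat \<bar>b\<bar>"
    by (simp add: abs_mult nat_mult_distrib)
  also have "\<dots> < 2 ^ ?f a * 2 ^ ?f b"
    by (intro mult_strict_mono less_power_floorlog) simp_all
  also have "\<dots> = 2 ^ (?f a + ?f b)"
    by (simp add: power_add)
  finally show ?thesis
    unfolding floorlog_le[symmetric] by simp
qed

lemma abs_div_le: "\<bar>a div b\<bar> \<le> \<bar>a :: int\<bar>"
proof -
  have pos: "\<bar>a div b\<bar> \<le> \<bar>a\<bar>" if "0 < b" for a b :: int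
    using that by (smt (verit) div_by_1 pos_imp_zdiv_neg_iff zdiv_mono2 zdiv_mono2_neg)
  consider "0 < b" | "b = 0" | "0 < - b"
    by linarith
  then show ?thesis
    using pos[of b a] pos[of "- b" "- a"] by cases auto
qed

lemma vsize_div: "vsize (Num (a div b)) \<le> 1 + vsize (Num a)"
  using vsize_Num_mono[OF abs_div_le] le_SucI by fastforce

lemma vsize_binop: "vsize (binop_val f u v) \<le> 2 + vsize u + vsize v"
proof (cases "(f, u, v)" rule: binop_val.cases)
  case (2 a b)
  then show ?thesis using vsize_add[of a b] by simp
next
  case (3 a b)
  then show ?thesis using vsize_diff[of a b] by simp
next
  case (4 a b)
  then show ?thesis using vsize_mult[of a b] by simp
next
  case (5 a b)
  then show ?thesis using vsize_div[of a b] by simp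
qed (auto simp: floorlog_def)

lemma ptime_binop:
  assumes "ptime f" "ptime g" "\<And>x. enc (h x) = binop_val b (enc (f x)) (enc (g x))"
  shows "ptime h"
proof -
  obtain P e\<^sub>1 e\<^sub>2 q\<^sub>1 q\<^sub>2 where c: "computes P e\<^sub>1 q\<^sub>1 f" "computes P e\<^sub>2 q\<^sub>2 g"
    by (rule ptime_link[OF assms(1,2)])
  show ?thesis
  proof (rule ptimeI)
    fix x
    note f = computesD[OF c(1), of x] and g = computesD[OF c(2), of x]
    have "sz (h x) \<le> 2 + poly q\<^sub>1 (sz x) + poly q\<^sub>2 (sz x)"
      using vsize_binop[of b "enc (f x)" "enc (g x)"] evalb_vsize[OF f] evalb_vsize[OF g]
      by (simp add: assms(3))
    then show "evalb P [enc x] (Binop b e\<^sub>1 e\<^sub>2) (enc (h x))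
      ((\<lambda>n. 1 + (2 + poly q\<^sub>1 n + poly q\<^sub>2 n) + poly q\<^sub>1 n + poly q\<^sub>2 n) (sz x))"
      by (intro evalb_mono[OF evalb_Binop[OF f g assms(3)]]) simp
  qed (intro pbound_intros)
qed

lemma ptime_if [ptime_intros]:
  assumes "ptime b" "ptime f" "ptime g"
  shows "ptime (\<lambda>x. if b x then f x else g x)"
proof -
  obtain P e\<^sub>1 e\<^sub>2 e\<^sub>3 q\<^sub>1 q\<^sub>2 q\<^sub>3
    where c: "computes P e\<^sub>1 q\<^sub>1 b" "computes P e\<^sub>2 q\<^sub>2 f" "computes P e\<^sub>3 q\<^sub>3 g"
    by (rule ptime_link3[OF assms])
  show ?thesis
  proof (rule ptimeI)
    fix x
    show "evalb P [enc x] (Cond e\<^sub>1 e\<^sub>2 e\<^sub>3) (enc (if b x then f x else g x))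
      ((\<lambda>n. 1 + poly q\<^sub>1 n + (poly q\<^sub>2 n + poly q\<^sub>3 n)) (sz x))"
      by (intro evalb_Cond[OF computesD[OF c(1)]])
        (auto simp: enc_bool_def split: if_splits
          intro: evalb_mono[OF computesD[OF c(2)]] evalb_mono[OF computesD[OF c(3)]])
  qed (intro pbound_intros)
qed

section \<open>Folding over a list\<close>

lemma length_le_sz: "length xs \<le> sz xs"
  by (induction xs) auto

text \<open>Iterating a polynomial step may blow up the state, so the bound \<open>B\<close> on the
  states after all prefixes is a separate hypothesis. The loop becomes one recursive function of the
  parameter, the remaining list and the state.\<close>

lemma ptime_fold:
  fixes f :: "'a::encodable \<Rightarrow> 'b::encodable \<Rightarrow> 'c::encodable \<Rightarrow> 'c"
  assumes "ptime (\<lambda>p. f (fst p) (fst (snd p)) (snd (snd p)))" "ptime l" "ptime i"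
    and B: "pbound B" "\<And>x k. sz (fold (f x) (take k (l x)) (i x)) \<le> B (sz x)"
  shows "ptime (\<lambda>x. fold (f x) (l x) (i x))"
proof -
  obtain P e\<^sub>1 e\<^sub>2 e\<^sub>3 q\<^sub>1 q\<^sub>2 q\<^sub>3 where
    c: "computes P e\<^sub>1 q\<^sub>1 (\<lambda>p. f (fst p) (fst (snd p)) (snd (snd p)))"
      "computes P e\<^sub>2 q\<^sub>2 l" "computes P e\<^sub>3 q\<^sub>3 i"
    by (rule ptime_link3[OF assms(1-3)])
  \<comment> \<open>This becomes function number \<open>length P\<close>, so the call in it is
    recursive. \<open>Bind\<close> pushes the argument triple to the front, where
    \<open>e\<^sub>1\<close> expects its only input.\<close>
  define body where "body = Cond (Unop IsNode (Var 1))
    (Call (length P) [Var 0, Unop Snd (Var 1),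
      Bind (Binop MkNode (Var 0) (Binop MkNode (Unop Fst (Var 1)) (Var 2))) e\<^sub>1]) (Var 2)"
  define P' where "P' = P @ [body]"
  have c': "computes P' e\<^sub>1 q\<^sub>1 (\<lambda>p. f (fst p) (fst (snd p)) (snd (snd p)))"
      "computes P' e\<^sub>2 q\<^sub>2 l" "computes P' e\<^sub>3 q\<^sub>3 i"
    using c unfolding P'_def by (auto intro: computes_append)
  \<comment> \<open>A generous cost of one iteration when parameter, list and state have size at
    most \<open>M\<close>; \<open>2 + 3 * M\<close> bounds the size of the triple passed to
    \<open>f\<close>.\<close>
  define C where "C M = 40 + 20 * M + poly q\<^sub>1 (2 + 3 * M)" for M :: nat
  have loop: "evalb P' [enc x, enc xs, enc s] body (enc (fold (f x) xs s)) (Suc (length xs) * C M)"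
    if "sz x \<le> M" "sz xs \<le> M" "\<And>k. sz (fold (f x) (take k xs) s) \<le> M" for x xs s M
    using that
  proof (induction xs arbitrary: s)
    case Nil
    have "sz s \<le> M"
      using Nil(3)[of 0] by simp
    let ?\<rho> = "[enc x, enc ([] :: 'b list), enc s]"
    have v1: "evalb P' ?\<rho> (Unop IsNode (Var 1)) (Num 0) (1 + vsize (Num 0) + (1 + vsize (Num 0)))"
      by (rule evalb_Unop[OF evalb_Var]) auto
    have v2: "evalb P' ?\<rho> (Var 2) (enc s) (1 + sz s)"
      by (rule evalb_Var) auto
    have "evalb P' ?\<rho> body (enc s) (1 + (1 + vsize (Num 0) + (1 + vsize (Num 0))) + (1 + sz s))"
      unfolding body_def by (rule evalb_Cond[OF v1]) (use v2 in auto)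
    then show ?case
      using \<open>sz s \<le> M\<close> by (auto simp: C_def floorlog_def intro: evalb_mono)
  next
    case (Cons a xs)
    have s: "sz s \<le> M"
      using Cons.prems(3)[of 0] by simp
    have a: "sz a + sz xs < M"
      using Cons.prems(2) by simp
    let ?\<rho> = "[enc x, enc (a # xs), enc s]" and ?p = "enc (x, a, s)"
    have IH: "evalb P' [enc x, enc xs, enc (f x a s)] body (enc (fold (f x) xs (f x a s)))
      (Suc (length xs) * C M)"
    proof (rule Cons.IH)
      show "sz (fold (f x) (take k xs) (f x a s)) \<le> M" for k
        using Cons.prems(3)[of "Suc k"] by simp
    qed (use Cons.prems in auto)
    have fst: "evalb P' ?\<rho> (Unop Fst (Var 1)) (enc a) (1 + sz a + (1 + sz (a # xs)))"
      by (rule evalb_Unop[OF evalb_Var]) auto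
    have snd: "evalb P' ?\<rho> (Unop Snd (Var 1)) (enc xs) (1 + sz xs + (1 + sz (a # xs)))"
      by (rule evalb_Unop[OF evalb_Var]) auto
    have v0: "evalb P' ?\<rho> (Var 0) (enc x) (1 + sz x)"
      by (rule evalb_Var) auto
    have v2: "evalb P' ?\<rho> (Var 2) (enc s) (1 + sz s)"
      by (rule evalb_Var) auto
    have pair: "evalb P' ?\<rho> (Binop MkNode (Var 0) (Binop MkNode (Unop Fst (Var 1)) (Var 2))) ?p
      (1 + vsize ?p + (1 + sz x) + (1 + sz (a, s) + (1 + sz a + (1 + sz (a # xs))) + (1 + sz s)))"
      by (intro evalb_Binop[OF v0 evalb_Binop[OF fst v2]]) auto
    have "evalb P' ([?p] @ ?\<rho>) e\<^sub>1 (enc (f x a s)) (poly q\<^sub>1 (sz (x, a, s)))"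
      using computesD[OF c'(1), of "(x, a, s)"] by (intro evalb_append_env) simp
    moreover have "poly q\<^sub>1 (sz (x, a, s)) \<le> poly q\<^sub>1 (2 + 3 * M)"
      using Cons.prems s a by (intro poly_mono_nat) simp
    ultimately have "evalb P' (?p # ?\<rho>) e\<^sub>1 (enc (f x a s)) (poly q\<^sub>1 (2 + 3 * M))"
      unfolding append.simps by (rule evalb_mono)
    note step = evalb_Bind[OF pair this]
    have "P' ! length P = body" "length P < length P'"
      by (auto simp: P'_def)
    note call = evalb_Call3[OF this(2) v0 snd step, unfolded this(1), OF IH]
    have v1: "evalb P' ?\<rho> (Unop IsNode (Var 1)) (Num 1) (1 + vsize (Num 1) + (1 + sz (a # xs)))"
      by (rule evalb_Unop[OF evalb_Var]) auto
    have "evalb P' ?\<rho> body (enc (fold (f x) xs (f x a s)))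
       (1 + (1 + vsize (Num 1) + (1 + sz (a # xs))) + (1 + ((1 + sz x) + ((1 + sz xs + (1 + sz (a # xs))) +
        (1 + (1 + vsize ?p + (1 + sz x) + (1 + sz (a, s) + (1 + sz a + (1 + sz (a # xs))) + (1 + sz s)))
         + poly q\<^sub>1 (2 + 3 * M)))) + Suc (length xs) * C M))" (is "evalb _ _ _ _ ?T")
      unfolding body_def
      by (rule evalb_Cond[OF v1]) (use call in \<open>auto simp: body_def\<close>)
    moreover have "?T \<le> C M + Suc (length xs) * C M"
      using Cons.prems(1) s a by (simp add: C_def floorlog_def compute_floorlog)
    ultimately show ?case
      by (auto intro: evalb_mono)
  qed
  let ?M = "\<lambda>n. n + poly q\<^sub>2 n + B n"
  let ?T = "\<lambda>n. 1 + (1 + n + (poly q\<^sub>2 n + poly q\<^sub>3 n)) + Suc (poly q\<^sub>2 n) * C (?M n)"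
  show ?thesis
  proof (rule ptimeI)
    fix x :: 'a
    note l = computesD[OF c'(2), of x] and i = computesD[OF c'(3), of x]
    have v0: "evalb P' [enc x] (Var 0) (enc x) (1 + sz x)"
      by (rule evalb_Var) auto
    have loop': "evalb P' [enc x, enc (l x), enc (i x)] body (enc (fold (f x) (l x) (i x)))
      (Suc (length (l x)) * C (?M (sz x)))"
      by (rule loop) (use evalb_vsize[OF l] B(2)[of x] in \<open>auto intro: trans_le_add2\<close>)
    have "length (l x) \<le> poly q\<^sub>2 (sz x)"
      using length_le_sz[of "l x"] evalb_vsize[OF l] by simp
    then have "Suc (length (l x)) * C (?M (sz x)) \<le> Suc (poly q\<^sub>2 (sz x)) * C (?M (sz x))"
      by (intro mult_right_mono) auto
    note loop'' = evalb_mono[OF loop' this]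
    have "P' ! length P = body" "length P < length P'"
      by (auto simp: P'_def)
    from evalb_Call3[OF this(2) v0 l i, unfolded this(1), OF loop'']
    show "evalb P' [enc x] (Call (length P) [Var 0, e\<^sub>2, e\<^sub>3]) (enc (fold (f x) (l x) (i x))) (?T (sz x))"
      by simp
  next
    show "pbound ?T"
      unfolding C_def Suc_eq_plus1 using B(1) by (intro pbound_intros)
  qed
qed

lemma sz_append: "sz (xs @ ys) + 1 = sz xs + sz ys"
  by (induction xs) (auto simp: floorlog_def)

lemma sz_member: "a \<in> set xs \<Longrightarrow> sz a < sz xs"
  by (induction xs) auto

lemma sz_filter: "sz (filter Q xs) \<le> sz xs"
  by (induction xs) auto

lemma sz_nat_le: "sz (n :: nat) \<le> Suc n"
proof -
  have "n < 2 ^ n" by simp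
  then show ?thesis
    by (simp add: enc_nat_def floorlog_le)
qed

lemma sz_take: "sz (take k xs) \<le> sz xs"
proof (induction xs arbitrary: k)
  case (Cons a xs)
  then show ?case by (cases k) (auto simp: floorlog_def)
qed simp

section \<open>Pairs, Booleans and numbers\<close>

lemma ptime_fst [ptime_intros]: "ptime f \<Longrightarrow> ptime (\<lambda>x. fst (f x))"
  by (rule ptime_unop[where u = Fst]) (auto simp: enc_prod_def)

lemma ptime_snd [ptime_intros]: "ptime f \<Longrightarrow> ptime (\<lambda>x. snd (f x))"
  by (rule ptime_unop[where u = Snd]) (auto simp: enc_prod_def)

lemma ptime_Pair [ptime_intros]: "ptime f \<Longrightarrow> ptime g \<Longrightarrow> ptime (\<lambda>x. (f x, g x))"
  by (rule ptime_binop[where b = MkNode and f = f and g = g]) auto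

lemma ptime_Cons [ptime_intros]: "ptime f \<Longrightarrow> ptime g \<Longrightarrow> ptime (\<lambda>x. f x # g x)"
  by (rule ptime_binop[where b = MkNode and f = f and g = g]) auto

lemma ptime_compose2:
  assumes "ptime (\<lambda>p. g (fst p) (snd p))" "ptime f" "ptime h"
  shows "ptime (\<lambda>x. g (f x) (h x))"
  using ptime_compose[OF assms(1) ptime_Pair[OF assms(2,3)]] by simp

lemma ptime_compose3:
  assumes "ptime (\<lambda>p. g (fst p) (fst (snd p)) (snd (snd p)))" "ptime f" "ptime h" "ptime k"
  shows "ptime (\<lambda>x. g (f x) (h x) (k x))"
  using ptime_compose[OF assms(1) ptime_Pair[OF assms(2) ptime_Pair[OF assms(3,4)]]] by simp

lemma ptime_compose4:
  assumes "ptime (\<lambda>p. g (fst p) (fst (snd p)) (fst (snd (snd p))) (snd (snd (snd p))))"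
    "ptime f" "ptime h" "ptime k" "ptime l"
  shows "ptime (\<lambda>x. g (f x) (h x) (k x) (l x))"
  using ptime_compose[OF assms(1) ptime_Pair[OF assms(2) ptime_Pair[OF assms(3) ptime_Pair[OF assms(4,5)]]]]
  by simp

lemma ptime_tl [ptime_intros]: "ptime f \<Longrightarrow> ptime (\<lambda>x. tl (f x))"
proof (rule ptime_unop[where u = Snd and f = f])
  show "enc (tl (f x)) = unop_val Snd (enc (f x))" for x
    by (cases "f x") auto
qed

lemma ptime_not [ptime_intros]: assumes "ptime b" shows "ptime (\<lambda>x. \<not> b x)"
proof -
  have "(\<lambda>x. \<not> b x) = (\<lambda>x. if b x then False else True)"
    by auto
  then show ?thesis
    using assms by (simp only:) (intro ptime_intros)
qed

lemma ptime_conj [ptime_intros]: assumes "ptime b" "ptime c" shows "ptime (\<lambda>x. b x \<and> c x)"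
proof -
  have "(\<lambda>x. b x \<and> c x) = (\<lambda>x. if b x then c x else False)"
    by auto
  then show ?thesis
    using assms by (simp only:) (intro ptime_intros)
qed

lemma ptime_null [ptime_intros]: assumes "ptime f" shows "ptime (\<lambda>x. f x = [])"
proof -
  have "ptime (\<lambda>x. f x \<noteq> [])"
  proof (rule ptime_unop[where u = IsNode and f = f, OF assms])
    show "enc (f x \<noteq> []) = unop_val IsNode (enc (f x))" for x
      by (cases "f x") (auto simp: enc_bool_def)
  qed
  from ptime_not[OF this] show ?thesis by simp
qed

lemma ptime_int_add [ptime_intros]: "ptime f \<Longrightarrow> ptime g \<Longrightarrow> ptime (\<lambda>x. f x + g x :: int)"
  by (rule ptime_binop[where b = Add and f = f and g = g]) (auto simp: enc_int_def)

lemma ptime_int_mult [ptime_intros]: "ptime f \<Longrightarrow> ptime g \<Longrightarrow> ptime (\<lambda>x. f x * g x :: int)"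
  by (rule ptime_binop[where b = Mul and f = f and g = g]) (auto simp: enc_int_def)

lemma ptime_int_div [ptime_intros]: "ptime f \<Longrightarrow> ptime g \<Longrightarrow> ptime (\<lambda>x. f x div g x :: int)"
  by (rule ptime_binop[where b = Div and f = f and g = g]) (auto simp: enc_int_def)

lemma ptime_int_le [ptime_intros]: "ptime f \<Longrightarrow> ptime g \<Longrightarrow> ptime (\<lambda>x. (f x :: int) \<le> g x)"
  by (rule ptime_binop[where b = Leq and f = f and g = g]) (auto simp: enc_int_def enc_bool_def)

lemma ptime_int_less [ptime_intros]: "ptime f \<Longrightarrow> ptime g \<Longrightarrow> ptime (\<lambda>x. (f x :: int) < g x)"
  unfolding not_le[symmetric] by (intro ptime_intros)

lemma ptime_int_max [ptime_intros]:
  "ptime f \<Longrightarrow> ptime g \<Longrightarrow> ptime (\<lambda>x. max (f x) (g x) :: int)"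
  unfolding max_def by (intro ptime_intros)

lemma ptime_int [ptime_intros]: "ptime f \<Longrightarrow> ptime (\<lambda>x. int (f x))"
  by (rule ptime_cast) (auto simp: enc_int_def enc_nat_def)

lemma ptime_nat [ptime_intros]: assumes "ptime f" shows "ptime (\<lambda>x. nat (f x))"
proof (rule ptime_cast)
  show "ptime (\<lambda>x. if 0 \<le> f x then f x else 0)"
    using assms by (intro ptime_intros)
qed (auto simp: enc_int_def enc_nat_def)

lemma ptime_nat_add [ptime_intros]: "ptime f \<Longrightarrow> ptime g \<Longrightarrow> ptime (\<lambda>x. f x + g x :: nat)"
  by (rule ptime_cast[where f = "\<lambda>x. int (f x) + int (g x)"])
    (auto simp: enc_int_def enc_nat_def intro: ptime_intros)

lemma ptime_Suc [ptime_intros]: "ptime f \<Longrightarrow> ptime (\<lambda>x. Suc (f x))"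
  unfolding Suc_eq_plus1 by (intro ptime_intros)

lemma ptime_nat_le [ptime_intros]: "ptime f \<Longrightarrow> ptime g \<Longrightarrow> ptime (\<lambda>x. (f x :: nat) \<le> g x)"
  unfolding of_nat_le_iff[where 'a = int, symmetric] by (intro ptime_intros)

lemma ptime_nat_less [ptime_intros]: "ptime f \<Longrightarrow> ptime g \<Longrightarrow> ptime (\<lambda>x. (f x :: nat) < g x)"
  unfolding of_nat_less_iff[where 'a = int, symmetric] by (intro ptime_intros)

lemma ptime_nat_eq [ptime_intros]: "ptime f \<Longrightarrow> ptime g \<Longrightarrow> ptime (\<lambda>x. (f x :: nat) = g x)"
  unfolding eq_iff by (intro ptime_intros)

lemma ptime_quotient_of [ptime_intros]: "ptime f \<Longrightarrow> ptime (\<lambda>x. quotient_of (f x))"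
  by (rule ptime_cast[of f]) (auto simp: enc_rat_def encode_rat_def enc_int_def split: prod.splits)

lemma rat_le_quotient_of:
  "r \<le> s \<longleftrightarrow> fst (quotient_of r) * snd (quotient_of s) \<le> fst (quotient_of s) * snd (quotient_of r)"
  by (simp add: rat_less_eq_code split_beta mult.commute)

lemma ptime_rat_le [ptime_intros]: "ptime f \<Longrightarrow> ptime g \<Longrightarrow> ptime (\<lambda>x. (f x :: rat) \<le> g x)"
  unfolding rat_le_quotient_of by (intro ptime_intros)

lemma ptime_rat_less [ptime_intros]: "ptime f \<Longrightarrow> ptime g \<Longrightarrow> ptime (\<lambda>x. (f x :: rat) < g x)"
  unfolding not_le[symmetric] by (intro ptime_intros)

text \<open>If the growth per step does not depend on the state, sizes add up linearly and the bound
  required by \<open>ptime_fold\<close> follows from the length of the list.\<close>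

lemma ptime_fold_growth:
  fixes f :: "'a::encodable \<Rightarrow> 'b::encodable \<Rightarrow> 'c::encodable \<Rightarrow> 'c"
  assumes "ptime (\<lambda>p. f (fst p) (fst (snd p)) (snd (snd p)))" "ptime l" "ptime i"
    and G: "pbound G" "mono G" "\<And>x a s. sz (f x a s) \<le> sz s + G (sz x + sz a)"
  shows "ptime (\<lambda>x. fold (f x) (l x) (i x))"
proof -
  obtain Bl where Bl: "pbound Bl" "\<And>x. sz (l x) \<le> Bl (sz x)"
    using ptime_size[OF assms(2)] by metis
  obtain Bi where Bi: "pbound Bi" "\<And>x. sz (i x) \<le> Bi (sz x)"
    using ptime_size[OF assms(3)] by metis
  show ?thesis
  proof (rule ptime_fold[OF assms(1-3)])
    show "pbound (\<lambda>n. Bi n + Bl n * G (n + Bl n))"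
      by (intro pbound_intros pbound_compose[OF G(1)] Bl(1) Bi(1))
    fix x k
    have *: "sz (fold (f x) xs s) \<le> sz s + length xs * G (sz x + Bl (sz x))"
      if "\<And>a. a \<in> set xs \<Longrightarrow> sz a \<le> Bl (sz x)" for xs s
      using that
    proof (induction xs arbitrary: s)
      case (Cons a xs)
      have "sz (fold (f x) xs (f x a s)) \<le> sz (f x a s) + length xs * G (sz x + Bl (sz x))"
        by (rule Cons.IH) (use Cons.prems in auto)
      also have "sz (f x a s) \<le> sz s + G (sz x + sz a)"
        by (rule G(3))
      also have "G (sz x + sz a) \<le> G (sz x + Bl (sz x))"
        by (rule monoD[OF G(2)]) (use Cons.prems in auto)
      finally show ?case by simp
    qed simp
    have "sz (fold (f x) (take k (l x)) (i x))
      \<le> sz (i x) + length (take k (l x)) * G (sz x + Bl (sz x))"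
      using sz_member[of _ "l x"] Bl(2)[of x] by (intro *) (meson in_set_takeD less_or_eq_imp_le order_trans)
    also have "\<dots> \<le> Bi (sz x) + Bl (sz x) * G (sz x + Bl (sz x))"
      using Bi(2)[of x] Bl(2)[of x] length_le_sz[of "l x"] by (intro add_mono mult_right_mono) auto
    finally show "sz (fold (f x) (take k (l x)) (i x)) \<le> Bi (sz x) + Bl (sz x) * G (sz x + Bl (sz x))" .
  qed
qed

lemma ptime_fold_const_growth:
  fixes f :: "'a::encodable \<Rightarrow> 'b::encodable \<Rightarrow> 'c::encodable \<Rightarrow> 'c"
  assumes "ptime (\<lambda>p. f (fst p) (fst (snd p)) (snd (snd p)))" "ptime l" "ptime i"
    and "\<And>x a s. sz (f x a s) \<le> sz s + sz a + k"
  shows "ptime (\<lambda>x. fold (f x) (l x) (i x))"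
proof (rule ptime_fold_growth[OF assms(1-3)])
  show "sz (f x a s) \<le> sz s + (sz x + sz a + k)" for x a s
    using assms(4)[of x a s] by simp
qed (auto intro: pbound_intros monoI)

section \<open>List functions\<close>

lemma ptime_rev [ptime_intros]: assumes "ptime l" shows "ptime (\<lambda>x. rev (l x))"
proof -
  have "ptime (\<lambda>x. fold (\<lambda>a s. a # s) (l x) [])"
    by (rule ptime_fold_const_growth[where k = 1]) (auto intro!: ptime_intros assms)
  then show ?thesis
    by (simp add: rev_conv_fold)
qed

lemma ptime_append [ptime_intros]: assumes "ptime l" "ptime m" shows "ptime (\<lambda>x. l x @ m x)"
proof -
  have "ptime (\<lambda>x. fold (\<lambda>a s. a # s) (rev (l x)) (m x))"
    by (rule ptime_fold_const_growth[where k = 1]) (auto intro!: ptime_intros assms)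
  then show ?thesis
    by (simp add: fold_Cons_rev)
qed

lemma ptime_map [ptime_intros]:
  assumes "ptime (\<lambda>p. g (fst p) (snd p))" "ptime l"
  shows "ptime (\<lambda>x. map (g x) (l x))"
proof -
  obtain G where G: "pbound G" "mono G" "\<And>p. sz (g (fst p) (snd p)) \<le> G (sz p)"
    using ptime_size[OF assms(1)] by metis
  have "ptime (\<lambda>x. fold (\<lambda>a s. g x a # s) (l x) [])"
  proof (rule ptime_fold_growth[where G = "\<lambda>n. Suc (G (Suc n))"])
    show "ptime (\<lambda>p. g (fst p) (fst (snd p)) # snd (snd p))"
      by (intro ptime_intros ptime_compose2[OF assms(1)])
    show "pbound (\<lambda>n. Suc (G (Suc n)))"
      by (intro pbound_intros pbound_compose[OF G(1)])
    show "sz (g x a # s) \<le> sz s + Suc (G (Suc (sz x + sz a)))" for x a s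
      using G(3)[of "(x, a)"] by simp
  qed (auto intro: ptime_intros assms(2) monoI monoD[OF G(2)])
  then have "ptime (\<lambda>x. rev (fold (\<lambda>a s. g x a # s) (l x) []))"
    by (intro ptime_intros)
  moreover have "fold (\<lambda>a s. g x a # s) xs s = rev (map (g x) xs) @ s" for x xs s
    by (induction xs arbitrary: s) auto
  ultimately show ?thesis
    by simp
qed

lemma ptime_filter [ptime_intros]:
  assumes "ptime (\<lambda>p. Q (fst p) (snd p))" "ptime l"
  shows "ptime (\<lambda>x. filter (Q x) (l x))"
proof -
  have "ptime (\<lambda>x. fold (\<lambda>a s. if Q x a then a # s else s) (l x) [])"
  proof (rule ptime_fold_const_growth[where k = 1])
    show "ptime (\<lambda>p. if Q (fst p) (fst (snd p)) then fst (snd p) # snd (snd p) else snd (snd p))"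
      by (intro ptime_intros ptime_compose2[OF assms(1)])
  qed (auto intro: ptime_intros assms(2))
  then have "ptime (\<lambda>x. rev (fold (\<lambda>a s. if Q x a then a # s else s) (l x) []))"
    by (intro ptime_intros)
  moreover have "fold (\<lambda>a s. if Q x a then a # s else s) xs s = rev (filter (Q x) xs) @ s" for x xs s
    by (induction xs arbitrary: s) auto
  ultimately show ?thesis
    by simp
qed

lemma ptime_list_ex [ptime_intros]:
  assumes "ptime (\<lambda>p. Q (fst p) (snd p))" "ptime l"
  shows "ptime (\<lambda>x. list_ex (Q x) (l x))"
proof -
  have "list_ex (Q x) (l x) \<longleftrightarrow> \<not> filter (Q x) (l x) = []" for x
    by (auto simp: list_ex_iff filter_empty_conv)
  then show ?thesis
    using assms by (simp only:) (intro ptime_intros)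
qed

lemma ptime_list_all [ptime_intros]:
  assumes "ptime (\<lambda>p. Q (fst p) (snd p))" "ptime l"
  shows "ptime (\<lambda>x. list_all (Q x) (l x))"
proof -
  have "list_all (Q x) (l x) \<longleftrightarrow> filter (\<lambda>a. \<not> Q x a) (l x) = []" for x
    by (auto simp: list_all_iff filter_empty_conv)
  then show ?thesis
    using assms by (simp only:) (intro ptime_intros)
qed

lemma ptime_member [ptime_intros]:
  assumes "ptime f" "ptime l"
  shows "ptime (\<lambda>x. (f x :: nat) \<in> set (l x))"
proof -
  have "f x \<in> set (l x) \<longleftrightarrow> list_ex (\<lambda>a. f x = a) (l x)" for x
    by (auto simp: list_ex_iff)
  then show ?thesis
    by (simp only:) (intro ptime_intros ptime_compose[OF assms(1)] assms(2))
qed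

lemma ptime_concat [ptime_intros]: assumes "ptime l" shows "ptime (\<lambda>x. concat (l x))"
proof -
  have "ptime (\<lambda>x. fold (\<lambda>a s. s @ a) (l x) [])"
    by (rule ptime_fold_const_growth[where k = 0])
      (auto intro!: ptime_intros assms, metis add_leD1 order_refl sz_append)
  moreover have "fold (\<lambda>a s. s @ a) xs s = s @ concat xs" for xs and s :: "'b list"
    by (induction xs arbitrary: s) auto
  ultimately show ?thesis
    by simp
qed

lemma sz_Suc: "sz (Suc n) \<le> sz n + 2"
proof -
  have "vsize (Num 1) = 2"
    by (simp add: floorlog_def)
  then show ?thesis
    using vsize_add[of "int n" 1] by (simp add: enc_nat_def add.commute)
qed

lemma ptime_length [ptime_intros]: assumes "ptime l" shows "ptime (\<lambda>x. length (l x))"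
proof -
  have "ptime (\<lambda>x. fold (\<lambda>a n. Suc n) (l x) 0)"
    by (rule ptime_fold_const_growth[where k = 2])
      (auto intro!: ptime_intros assms le_trans[OF sz_Suc])
  moreover have "fold (\<lambda>a n. Suc n) xs n = n + length xs" for xs :: "'b list" and n
    by (induction xs arbitrary: n) auto
  ultimately show ?thesis
    by simp
qed

lemma ptime_sum_list [ptime_intros]:
  assumes "ptime l" shows "ptime (\<lambda>x. sum_list (l x) :: int)"
proof -
  have "ptime (\<lambda>x. fold (\<lambda>a s. a + s) (l x) (0 :: int))"
    by (rule ptime_fold_const_growth[where k = 0])
      (use vsize_add in \<open>auto intro!: ptime_intros assms simp: enc_int_def add.commute simp del: vsize.simps\<close>)
  moreover have "fold (\<lambda>a s. a + s) xs s = s + sum_list xs" for xs and s :: int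
    by (induction xs arbitrary: s) auto
  ultimately show ?thesis
    by simp
qed

lemma ptime_prod_list [ptime_intros]:
  assumes "ptime l" shows "ptime (\<lambda>x. prod_list (l x) :: int)"
proof -
  have "ptime (\<lambda>x. fold (\<lambda>a s. a * s) (l x) (1 :: int))"
    by (rule ptime_fold_const_growth[where k = 0])
      (use vsize_mult in \<open>auto intro!: ptime_intros assms simp: enc_int_def mult.commute add.commute simp del: vsize.simps\<close>)
  moreover have "fold (\<lambda>a s. a * s) xs s = s * prod_list xs" for xs and s :: int
    by (induction xs arbitrary: s) auto
  ultimately show ?thesis
    by simp
qed

lemma ptime_hd [ptime_intros]: assumes "ptime l" shows "ptime (\<lambda>x. hd (l x))"
proof -
  \<comment> \<open>The last entry of the reversed list survives; starting from the unspecified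
    constant \<open>hd []\<close> covers the empty list too.\<close>
  have "ptime (\<lambda>x. fold (\<lambda>a s. a) (rev (l x)) (hd []))"
    by (rule ptime_fold_const_growth[where k = 0]) (auto intro!: ptime_intros assms)
  moreover have "fold (\<lambda>a s. a) (rev xs) (hd []) = hd xs" for xs :: "'b list"
    by (cases xs) auto
  ultimately show ?thesis
    by simp
qed

lemma sz_enumerate: "sz (List.enumerate n xs) \<le> sz xs + length xs * (n + length xs + 3)"
proof (induction xs arbitrary: n)
  case (Cons a xs)
  then show ?case
    using Cons[of "Suc n"] sz_nat_le[of n] by (simp add: algebra_simps)
qed simp

lemma ptime_enumerate [ptime_intros]: assumes "ptime l" shows "ptime (\<lambda>x. List.enumerate 0 (l x))"
proof -
  obtain Bl where Bl: "pbound Bl" "\<And>x. sz (l x) \<le> Bl (sz x)"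
    using ptime_size[OF assms(1)] by metis
  let ?f = "\<lambda>a s. (Suc (fst s), snd s @ [(fst s, a)])"
  have fold: "fold ?f xs (n, s) = (n + length xs, s @ List.enumerate n xs)" for xs :: "'b list" and n s
    by (induction xs arbitrary: n s) auto
  have "ptime (\<lambda>x. fold ?f (l x) (0, []))"
  \<comment> \<open>Each step copies the counter, a part of the state, so the growth rule does not
    apply; the closed form \<open>fold\<close> of the states bounds them instead.\<close>
  proof (rule ptime_fold)
    show "sz (fold ?f (take k (l x)) (0, [])) \<le>
      (\<lambda>n. 2 + Bl n + Bl n + Bl n * (Bl n + 3)) (sz x)" for x k
    proof -
      let ?xs = "take k (l x)"
      have 1: "sz ?xs \<le> Bl (sz x)"
        using sz_take Bl(2) le_trans by blast
      then have 2: "length ?xs \<le> Bl (sz x)"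
        using length_le_sz le_trans by blast
      then have "length ?xs * (length ?xs + 3) \<le> Bl (sz x) * (Bl (sz x) + 3)"
        by (intro mult_mono) auto
      then have "sz (List.enumerate 0 ?xs) \<le> Bl (sz x) + Bl (sz x) * (Bl (sz x) + 3)"
        using sz_enumerate[of 0 ?xs] 1 by simp
      moreover have "sz (length ?xs) \<le> Suc (Bl (sz x))"
        using sz_nat_le[of "length ?xs"] 2 by simp
      ultimately show ?thesis
        unfolding fold by simp
    qed
  qed (use Bl(1) in \<open>auto intro!: ptime_intros pbound_intros assms\<close>)
  then have "ptime (\<lambda>x. snd (fold ?f (l x) (0, [])))"
    by (intro ptime_intros)
  then show ?thesis
    by (simp add: fold)
qed

section \<open>The algorithm\<close>

text \<open>An item is a load, a demand and the indices of the jobs in it.  A core is its load in units, the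
  demand of its first item and the indices of its jobs.\<close>

type_synonym item = "int \<times> rat \<times> nat list"
type_synonym core = "nat \<times> rat \<times> nat list"
type_synonym inst = "(rat \<times> rat) list \<times> nat \<times> rat"

abbreviation dem :: "'a \<times> rat \<times> nat list \<Rightarrow> rat" where "dem c \<equiv> fst (snd c)"
abbreviation ids :: "'a \<times> rat \<times> nat list \<Rightarrow> nat list" where "ids c \<equiv> snd (snd c)"

text \<open>The integer \<open>D * r\<close> whenever the denominator of \<open>r\<close> divides
  \<open>D\<close>.\<close>

definition scale :: "int \<Rightarrow> rat \<Rightarrow> int" where
  "scale D r = fst (quotient_of r) * (D div snd (quotient_of r))"

definition denom :: "inst \<Rightarrow> int" where
  "denom I = prod_list (map (\<lambda>j. snd (quotient_of (fst j)) * snd (quotient_of (snd j))) (fst I)) *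
    snd (quotient_of (snd (snd I)))"

definition insert_item :: "item \<Rightarrow> item list \<Rightarrow> item list" where
  "insert_item it xs = filter (\<lambda>y. dem it < dem y) xs @
    it # filter (\<lambda>y. \<not> dem it < dem y) xs"

definition sort_items :: "item list \<Rightarrow> item list" where
  "sort_items xs = fold insert_item xs []"

definition merge :: "item \<Rightarrow> item \<Rightarrow> item" where
  "merge a b = (fst a + fst b, dem a, ids a @ ids b)"

text \<open>The bundle being filled is the head of the list.  It inherits the demand of its first item, which
  is the largest one when items arrive by decreasing demand.\<close>

definition bundle_step :: "int \<Rightarrow> item \<Rightarrow> item list \<Rightarrow> item list" where
  "bundle_step h it bs =
    (if bs = [] then [it]
     else if h \<le> fst (hd bs) then it # bs
     else merge (hd bs) it # tl bs)"

definition bundles :: "int \<Rightarrow> item list \<Rightarrow> item list" where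
  "bundles h xs = fold (bundle_step h) xs []"

definition pack :: "int \<Rightarrow> item list \<Rightarrow> item list" where
  "pack h xs = sort_items (filter (\<lambda>it. h \<le> fst it) xs @
    bundles h (sort_items (filter (\<lambda>it. fst it < h) xs)))"

text \<open>Loads are rounded up to multiples of \<open>u\<close>.  Weights are positive, so that level \<open>0\<close> means that a
  core is empty.\<close>

definition weight :: "int \<Rightarrow> item \<Rightarrow> nat" where
  "weight u it = Suc (nat (fst it div u))"

definition place :: "int \<Rightarrow> item \<Rightarrow> core \<Rightarrow> core" where
  "place u it c = (fst c + weight u it, if fst c = 0 then dem it else dem c,
    ids it @ ids c)"

text \<open>Replacing an entry is spelled out with \<open>List.enumerate\<close> to stay within the
  calculus; \<open>children_eq\<close> gives the form used in the proofs.\<close>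

definition children :: "nat \<Rightarrow> int \<Rightarrow> item \<Rightarrow> core list \<Rightarrow> core list list" where
  "children L u it e = filter (\<lambda>e. list_all (\<lambda>c. fst c \<le> L) e)
    (map (\<lambda>i. map (\<lambda>jc. if fst jc = i then place u it (snd jc) else snd jc) (List.enumerate 0 e))
      (map fst (List.enumerate 0 e)))"

definition same_levels :: "nat \<Rightarrow> core list \<Rightarrow> core list \<Rightarrow> bool" where
  "same_levels L e e' \<longleftrightarrow> list_all (\<lambda>k.
    length (filter (\<lambda>c. fst c = k) e) = length (filter (\<lambda>c. fst c = k) e')) [0..<Suc L]"

definition cost :: "int \<Rightarrow> core list \<Rightarrow> int" where
  "cost D e = sum_list (map (\<lambda>c. scale D (dem c)) e)"

definition add_entry :: "nat \<Rightarrow> int \<Rightarrow> core list \<Rightarrow> core list list \<Rightarrow> core list list" where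
  "add_entry L D e es =
    (if list_ex (\<lambda>e'. same_levels L e e' \<and> cost D e' \<le> cost D e) es then es
     else e # filter (\<lambda>e'. \<not> same_levels L e e') es)"

definition dp_step :: "nat \<Rightarrow> int \<Rightarrow> int \<Rightarrow> item \<Rightarrow> core list list \<Rightarrow> core list list" where
  "dp_step L D u it es = fold (add_entry L D) (concat (map (children L u it) es)) []"

definition dp :: "nat \<Rightarrow> int \<Rightarrow> int \<Rightarrow> item list \<Rightarrow> core list \<Rightarrow> core list list" where
  "dp L D u its e = fold (dp_step L D u) its [e]"

definition max_load :: "inst \<Rightarrow> int" where
  "max_load I = fold max (map (\<lambda>j. scale (denom I) (fst j)) (fst I)) 0"

definition items :: "nat \<Rightarrow> inst \<Rightarrow> item list" where
  "items m I = map (\<lambda>ij. (int m ^ 3 * scale (denom I) (fst (snd ij)), snd (snd ij), [fst ij]))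
    (List.enumerate 0 (fst I))"

text \<open>The job list serves as a counter: \<open>min\<close> of the numbers of cores and jobs is
  produced without ever counting up to the binary number of cores.\<close>

definition empty_cores :: "inst \<Rightarrow> core list" where
  "empty_cores I = map (\<lambda>ij. (0, 0, [])) (filter (\<lambda>ij. fst ij < fst (snd I)) (List.enumerate 0 (fst I)))"

text \<open>Only the length \<open>n * m\<close> of the concatenated list matters: it provides the
  multipliers \<open>1, ..., n * m\<close> of the guesses.\<close>

definition units :: "nat \<Rightarrow> inst \<Rightarrow> int list" where
  "units m I = map (\<lambda>kj. (int (fst kj) + 1) * max_load I)
    (List.enumerate 0 (concat (map (\<lambda>j. [0..<m]) (fst I))))"

text \<open>\<open>m\<^sup>2 + 3 m + 3 = (m + 1) (m + 2) + 1\<close>: a core of load \<open>(m\<^sup>2 + 2 m) u\<close> grows by a factor of at most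
  \<open>(m + 1) / m\<close> when items of load at least \<open>m u\<close> are rounded up, and by one more unit for a light bundle.\<close>

definition solutions :: "nat \<Rightarrow> inst \<Rightarrow> int \<Rightarrow> core list list" where
  "solutions m I u = filter (\<lambda>e. cost (denom I) e \<le> scale (denom I) (snd (snd I)))
    (dp (m ^ 2 + 3 * m + 3) (denom I) u (pack (int m * u) (items m I)) (empty_cores I))"

definition core_of :: "core list \<Rightarrow> nat \<Rightarrow> nat" where
  "core_of e j = fst (hd (filter (\<lambda>ic. j \<in> set (ids (snd ic))) (List.enumerate 0 e)))"

definition answer :: "inst \<Rightarrow> core list list \<Rightarrow> rat list \<times> nat list" where
  "answer I es = (if es = [] then ([], [])
    else (map (\<lambda>c. dem c) (hd es), map (\<lambda>ij. core_of (hd es) (fst ij)) (List.enumerate 0 (fst I))))"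

definition algorithm :: "nat \<Rightarrow> inst \<Rightarrow> rat list \<times> nat list" where
  "algorithm m I = answer I (concat (map (solutions m I) (units m I)))"

subsection \<open>Running time\<close>

lemma ptime_scale [ptime_intros]: "ptime D \<Longrightarrow> ptime r \<Longrightarrow> ptime (\<lambda>x. scale (D x) (r x))"
  unfolding scale_def by (intro ptime_intros)

lemma ptime_denom [ptime_intros]: "ptime I \<Longrightarrow> ptime (\<lambda>x. denom (I x))"
  by (rule ptime_compose[of denom], unfold denom_def) (intro ptime_intros)

lemma ptime_insert_item [ptime_intros]:
  assumes "ptime it" "ptime xs" shows "ptime (\<lambda>x. insert_item (it x) (xs x))"
proof (rule ptime_compose2[OF _ assms])
  show "ptime (\<lambda>p. insert_item (fst p) (snd p))"
    unfolding insert_item_def by (intro ptime_intros)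
qed

lemma ptime_sort_items [ptime_intros]: "ptime xs \<Longrightarrow> ptime (\<lambda>x. sort_items (xs x))"
  unfolding sort_items_def
proof (rule ptime_fold_const_growth[where k = 2])
  fix it :: item and xs :: "item list"
  let ?P = "\<lambda>y. dem it < dem y"
  have "sz (filter ?P xs) + sz (filter (\<lambda>y. \<not> ?P y) xs) = sz xs + 1"
    by (induction xs) (auto simp: floorlog_def)
  then show "sz (insert_item it xs) \<le> sz xs + sz it + 2"
    using sz_append[of "filter ?P xs" "it # filter (\<lambda>y. \<not> ?P y) xs"]
    by (simp add: insert_item_def)
qed (intro ptime_intros | assumption)+

lemma ptime_merge [ptime_intros]: "ptime a \<Longrightarrow> ptime b \<Longrightarrow> ptime (\<lambda>x. merge (a x) (b x))"
  unfolding merge_def by (intro ptime_intros)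

lemma sz_merge: "sz (merge a b) \<le> sz a + sz b"
  using sz_append[of "ids a" "ids b"] vsize_add[of "fst a" "fst b"]
  by (simp add: merge_def enc_prod_def enc_int_def del: vsize.simps(1))

lemma ptime_bundle_step [ptime_intros]:
  "ptime h \<Longrightarrow> ptime it \<Longrightarrow> ptime bs \<Longrightarrow> ptime (\<lambda>x. bundle_step (h x) (it x) (bs x))"
  unfolding bundle_step_def by (intro ptime_intros)

lemma ptime_bundles [ptime_intros]:
  assumes "ptime h" "ptime xs" shows "ptime (\<lambda>x. bundles (h x) (xs x))"
proof (rule ptime_compose2[OF _ assms], unfold bundles_def, rule ptime_fold_const_growth[where k = 2])
  fix h it and bs :: "item list"
  show "sz (bundle_step h it bs) \<le> sz bs + sz it + 2"
    using sz_merge[of "hd bs" it] by (cases bs) (auto simp: bundle_step_def floorlog_def)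
qed (intro ptime_intros)+

lemma ptime_pack [ptime_intros]:
  assumes "ptime h" "ptime xs" shows "ptime (\<lambda>x. pack (h x) (xs x))"
  by (rule ptime_compose2[OF _ assms], unfold pack_def) (intro ptime_intros)

lemma ptime_weight [ptime_intros]: "ptime u \<Longrightarrow> ptime it \<Longrightarrow> ptime (\<lambda>x. weight (u x) (it x))"
  unfolding weight_def by (intro ptime_intros)

lemma ptime_place [ptime_intros]:
  "ptime u \<Longrightarrow> ptime it \<Longrightarrow> ptime c \<Longrightarrow> ptime (\<lambda>x. place (u x) (it x) (c x))"
  unfolding place_def by (intro ptime_intros)

lemma ptime_children [ptime_intros]:
  assumes "ptime u" "ptime it" "ptime e" shows "ptime (\<lambda>x. children L (u x) (it x) (e x))"
  by (rule ptime_compose3[OF _ assms], unfold children_def) (intro ptime_intros)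

lemma ptime_same_levels [ptime_intros]:
  assumes "ptime e" "ptime e'" shows "ptime (\<lambda>x. same_levels L (e x) (e' x))"
  by (rule ptime_compose2[OF _ assms], unfold same_levels_def) (intro ptime_intros)

lemma ptime_cost [ptime_intros]:
  assumes "ptime D" "ptime e" shows "ptime (\<lambda>x. cost (D x) (e x))"
  by (rule ptime_compose2[OF _ assms], unfold cost_def) (intro ptime_intros)

lemma ptime_add_entry [ptime_intros]:
  assumes "ptime D" "ptime e" "ptime es" shows "ptime (\<lambda>x. add_entry L (D x) (e x) (es x))"
  by (rule ptime_compose3[OF _ assms], unfold add_entry_def) (intro ptime_intros)

lemma ptime_dp_step [ptime_intros]:
  assumes "ptime D" "ptime u" "ptime it" "ptime es"
  shows "ptime (\<lambda>x. dp_step L (D x) (u x) (it x) (es x))"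
proof (rule ptime_compose4[OF _ assms], unfold dp_step_def, rule ptime_fold_const_growth[where k = 1])
  fix p :: "int \<times> int \<times> item \<times> core list list" and e es
  show "sz (add_entry L (fst p) e es) \<le> sz es + sz e + 1"
    using sz_filter[of "\<lambda>e'. \<not> same_levels L e e'" es] by (auto simp: add_entry_def)
qed (intro ptime_intros)+

section \<open>Size of the tables of the dynamic program\<close>

lemma children_eq:
  "children L u it e = filter (\<lambda>e. list_all (\<lambda>c. fst c \<le> L) e)
    (map (\<lambda>i. e[i := place u it (e ! i)]) [0..<length e])"
proof -
  have "map (\<lambda>jc. if fst jc = i then place u it (snd jc) else snd jc) (List.enumerate 0 e) =
      e[i := place u it (e ! i)]" for i
    by (rule nth_equalityI) (auto simp: nth_enumerate_eq nth_list_update)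
  then show ?thesis
    by (simp add: children_def)
qed

lemma sz_list_update: "i < length xs \<Longrightarrow> sz (xs[i := y]) + sz (xs ! i) = sz xs + sz y"
  by (induction xs arbitrary: i) (auto split: nat.splits)

lemma sz_place: "fst (place u it c) \<le> L \<Longrightarrow> sz (place u it c) \<le> sz c + sz it + Suc L"
  using sz_nat_le[of "fst (place u it c)"] sz_append[of "ids it" "ids c"]
  by (auto simp: place_def enc_prod_def)

lemma sz_children:
  assumes "e' \<in> set (children L u it e)"
  shows "length e' = length e" "list_all (\<lambda>c. fst c \<le> L) e'" "sz e' \<le> sz e + sz it + Suc L"
proof -
  from assms obtain i where i: "e' = e[i := place u it (e ! i)]" "i < length e"
    "list_all (\<lambda>c. fst c \<le> L) e'"
    unfolding children_eq by auto
  have "e' ! i \<in> set e'"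
    using i(2) by (simp add: i(1) set_update_memI)
  with i(3) have "fst (e' ! i) \<le> L"
    by (simp add: list_all_iff)
  then have "fst (place u it (e ! i)) \<le> L"
    using i(2) by (simp add: i(1))
  from sz_place[OF this] show "sz e' \<le> sz e + sz it + Suc L"
    using sz_list_update[OF i(2), of "place u it (e ! i)"] by (simp add: i(1) del: enc_simps)
  show "length e' = length e"
    by (simp add: i(1))
  show "list_all (\<lambda>c. fst c \<le> L) e'"
    by (rule i(3))
qed

definition level_counts :: "nat \<Rightarrow> core list \<Rightarrow> nat list" where
  "level_counts L e = map (\<lambda>k. length (filter (\<lambda>c. fst c = k) e)) [0..<Suc L]"

lemma same_levels_iff: "same_levels L e e' \<longleftrightarrow> level_counts L e = level_counts L e'"
  by (auto simp: same_levels_def level_counts_def list_all_iff)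

lemma add_entry_subset: "set (fold (add_entry L D) cs es) \<subseteq> set cs \<union> set es"
proof (induction cs arbitrary: es)
  case (Cons c cs)
  have "set (add_entry L D c es) \<subseteq> insert c (set es)"
    by (auto simp: add_entry_def)
  then show ?case
    using Cons[of "add_entry L D c es"] by auto
qed simp

lemma dp_step_children:
  assumes "e \<in> set (dp_step L D u it es)"
  obtains e' where "e' \<in> set es" "e \<in> set (children L u it e')"
  using assms add_entry_subset[of L D "concat (map (children L u it) es)" "[]"]
  by (auto simp: dp_step_def)

lemma distinct_level_counts:
  "distinct (map (level_counts L) es) \<Longrightarrow>
    distinct (map (level_counts L) (fold (add_entry L D) cs es))"
proof (induction cs arbitrary: es)
  case (Cons c cs)
  then have "distinct (map (level_counts L) (add_entry L D c es))"
    by (auto simp: add_entry_def same_levels_iff intro: distinct_map_filter)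
  from Cons.IH[OF this] show ?case
    by simp
qed simp

text \<open>Level counts are vectors of length \<open>L + 1\<close> with entries up to
  \<open>n\<close>, and pruning keeps at most one entry per vector.\<close>

lemma length_dp_step:
  assumes "\<And>e. e \<in> set es \<Longrightarrow> length e = n"
  shows "length (dp_step L D u it es) \<le> Suc n ^ Suc L"
proof -
  let ?es = "dp_step L D u it es" and ?X = "{xs. set xs \<subseteq> {..n} \<and> length xs = Suc L}"
  have "level_counts L e \<in> ?X" if "e \<in> set ?es" for e
  proof -
    have "length e = n"
      using dp_step_children[OF that] assms sz_children(1) by metis
    then show ?thesis
      by (auto simp: level_counts_def)
  qed
  then have "set (map (level_counts L) ?es) \<subseteq> ?X"
    by auto
  moreover have "finite ?X" "card ?X = Suc n ^ Suc L"
    using finite_lists_length_eq[of "{..n}" "Suc L"] card_lists_length_eq[of "{..n}" "Suc L"] by simp_all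
  ultimately have "card (set (map (level_counts L) ?es)) \<le> Suc n ^ Suc L"
    using card_mono by metis
  moreover have "distinct (map (level_counts L) ?es)"
    unfolding dp_step_def by (rule distinct_level_counts) simp
  ultimately show ?thesis
    using distinct_card by fastforce
qed

text \<open>A step multiplies the table before pruning, so additive growth is visible only per
  entry: each entry gains at most the size of one item plus \<open>L + 1\<close>, while pruning caps
  their number afresh each time.\<close>

lemma dp_bounds:
  assumes "\<And>it. it \<in> set its \<Longrightarrow> sz it \<le> M"
    "\<And>e. e \<in> set es \<Longrightarrow> length e = n \<and> sz e \<le> S" "length es \<le> Suc n ^ Suc L"
  shows "length (fold (dp_step L D u) its es) \<le> Suc n ^ Suc L \<and>
    (\<forall>e\<in>set (fold (dp_step L D u) its es). sz e \<le> S + length its * (M + Suc L))"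
  using assms
proof (induction its arbitrary: es S)
  case (Cons it its)
  have *: "length e = n \<and> sz e \<le> S + (M + Suc L)" if e: "e \<in> set (dp_step L D u it es)" for e
  proof -
    obtain e' where e': "e' \<in> set es" "e \<in> set (children L u it e')"
      by (rule dp_step_children[OF e])
    then have "sz e' \<le> S" "length e' = n" "sz it \<le> M"
      using Cons.prems(1,2) by auto
    then show ?thesis
      using sz_children[OF e'(2)] by simp
  qed
  have "length (dp_step L D u it es) \<le> Suc n ^ Suc L"
    using Cons.prems(2) by (intro length_dp_step) auto
  from Cons.IH[OF _ * this] Cons.prems(1) show ?case
    by (simp add: algebra_simps)
qed simp

lemma sz_list_bound: "(\<And>x. x \<in> set xs \<Longrightarrow> sz x \<le> S) \<Longrightarrow> sz xs \<le> 1 + length xs * (1 + S)"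
proof (induction xs)
  case (Cons x xs)
  then have "sz xs \<le> 1 + length xs * (1 + S)" "sz x \<le> S"
    by auto
  then show ?case by simp
qed (simp add: floorlog_def)

lemma ptime_dp [ptime_intros]:
  assumes "ptime D" "ptime u" "ptime its" "ptime e"
  shows "ptime (\<lambda>x. dp L (D x) (u x) (its x) (e x))"
proof (rule ptime_compose4[OF _ assms], unfold dp_def, rule ptime_fold)
  fix p :: "int \<times> int \<times> item list \<times> core list" and k
  let ?n = "sz p" and ?e = "snd (snd (snd p))"
  let ?its = "take k (fst (snd (snd p)))"
  let ?es = "fold (dp_step L (fst p) (fst (snd p))) ?its [?e]"
  have its: "sz ?its \<le> ?n" and e: "sz ?e \<le> ?n"
    using sz_take[of k "fst (snd (snd p))"] by (auto simp: enc_prod_def)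
  have b: "length ?es \<le> Suc (length ?e) ^ Suc L \<and>
    (\<forall>e\<in>set ?es. sz e \<le> sz ?e + length ?its * (sz ?its + Suc L))"
    by (rule dp_bounds)
      (use sz_member[of _ ?its] one_le_power[of "Suc (length ?e)" "Suc L"]
        in \<open>auto intro: less_imp_le simp del: power_Suc\<close>)
  have "sz ?es \<le> 1 + length ?es * (1 + (sz ?e + length ?its * (sz ?its + Suc L)))"
    using b by (intro sz_list_bound) auto
  also have "\<dots> \<le> 1 + Suc ?n ^ Suc L * (1 + (?n + ?n * (?n + Suc L)))"
  proof (intro add_mono mult_mono le_refl)
    show "length ?es \<le> Suc ?n ^ Suc L"
      using b length_le_sz[of ?e] e power_mono[of "Suc (length ?e)" "Suc ?n" "Suc L"] by linarith
    show "length ?its \<le> ?n"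
      using length_le_sz[of ?its] its by simp
  qed (use its e in auto)
  finally show "sz ?es \<le> (\<lambda>n. 1 + Suc n ^ Suc L * (1 + (n + n * (n + Suc L)))) ?n" .
qed (intro ptime_intros pbound_intros)+

lemma ptime_max_load [ptime_intros]: "ptime I \<Longrightarrow> ptime (\<lambda>x. max_load (I x))"
proof (rule ptime_compose[of max_load], unfold max_load_def, rule ptime_fold_const_growth[where k = 0])
  show "sz (max a b) \<le> sz b + sz a + 0" for a b :: int
    by (auto simp: max_def)
qed (intro ptime_intros)+

lemma ptime_items [ptime_intros]: "ptime I \<Longrightarrow> ptime (\<lambda>x. items m (I x))"
  by (rule ptime_compose[of "items m"], unfold items_def) (intro ptime_intros)

lemma ptime_empty_cores [ptime_intros]: "ptime I \<Longrightarrow> ptime (\<lambda>x. empty_cores (I x))"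
  by (rule ptime_compose[of empty_cores], unfold empty_cores_def) (intro ptime_intros)

lemma ptime_units [ptime_intros]: "ptime I \<Longrightarrow> ptime (\<lambda>x. units m (I x))"
  by (rule ptime_compose[of "units m"], unfold units_def) (intro ptime_intros)

lemma ptime_solutions [ptime_intros]:
  assumes "ptime I" "ptime u" shows "ptime (\<lambda>x. solutions m (I x) (u x))"
  by (rule ptime_compose2[OF _ assms], unfold solutions_def) (intro ptime_intros)

lemma ptime_core_of [ptime_intros]:
  assumes "ptime e" "ptime j" shows "ptime (\<lambda>x. core_of (e x) (j x))"
  by (rule ptime_compose2[OF _ assms], unfold core_of_def) (intro ptime_intros)

lemma ptime_answer [ptime_intros]:
  assumes "ptime I" "ptime es" shows "ptime (\<lambda>x. answer (I x) (es x))"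
  by (rule ptime_compose2[OF _ assms], unfold answer_def) (intro ptime_intros)

lemma ptime_algorithm: "ptime (algorithm m)"
  unfolding algorithm_def by (intro ptime_intros)

section \<open>Correctness of the dynamic program\<close>

abbreviation decreasing :: "item list \<Rightarrow> bool" where
  "decreasing \<equiv> sorted_wrt (\<lambda>a b. dem b \<le> dem a)"

lemma mset_concat_list_update:
  "i < length e \<Longrightarrow> mset (concat (map ids (e[i := c]))) + mset (ids (e ! i)) =
    mset (concat (map ids e)) + mset (ids c)"
  by (induction e arbitrary: i) (auto split: nat.splits simp: ac_simps)

lemma cost_list_update:
  "i < length e \<Longrightarrow> cost D (e[i := c]) = cost D e - scale D (dem (e ! i)) + scale D (dem c)"
  by (induction e arbitrary: i) (auto split: nat.splits simp: cost_def)

text \<open>\<open>A j\<close> and \<open>R j\<close> are the load and the demand of job \<open>j\<close>.  \<open>Q\<close> is any property of demands that the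
  cores inherit from the items; later, that they are nonnegative and become integers when scaled.\<close>

locale job_data =
  fixes A :: "nat \<Rightarrow> int" and R :: "nat \<Rightarrow> rat" and Q :: "rat \<Rightarrow> bool"
begin

definition valid_item :: "item \<Rightarrow> bool" where
  "valid_item it \<longleftrightarrow> fst it = sum_list (map A (ids it)) \<and> Q (dem it) \<and> (\<forall>j\<in>set (ids it). R j \<le> dem it)"

text \<open>The last clause is what the decreasing order buys: once a core is in use, its recorded
  demand covers all items still to come.\<close>

definition valid_core :: "int \<Rightarrow> item list \<Rightarrow> core \<Rightarrow> bool" where
  "valid_core u its c \<longleftrightarrow> sum_list (map A (ids c)) \<le> u * int (fst c) \<and> Q (dem c) \<and>
    (\<forall>j\<in>set (ids c). R j \<le> dem c) \<and> (fst c = 0 \<longrightarrow> ids c = []) \<and>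
    (fst c > 0 \<longrightarrow> (\<forall>it\<in>set its. dem it \<le> dem c))"

lemma load_le_weight: "u > 0 \<Longrightarrow> fst it \<le> u * int (weight u it)"
proof -
  assume u: "u > 0"
  have "fst it \<le> u * (fst it div u) + u"
    using pos_mod_bound[OF u, of "fst it"] mult_div_mod_eq[of u "fst it"] by linarith
  also have "\<dots> = u * (fst it div u + 1)"
    by (simp add: algebra_simps)
  also have "\<dots> \<le> u * int (weight u it)"
    using u by (intro mult_left_mono) (auto simp: weight_def)
  finally show ?thesis .
qed

lemma valid_place:
  assumes "u > 0" "valid_item it" "decreasing (it # its)" "valid_core u (it # its) c"
  shows "valid_core u its (place u it c)"
proof -
  have "fst (place u it c) > 0"
    by (simp add: place_def weight_def)
  moreover have "sum_list (map A (ids (place u it c))) \<le> u * int (fst (place u it c))"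
    using assms load_le_weight[of u it]
    by (simp add: place_def valid_core_def valid_item_def algebra_simps)
  ultimately show ?thesis
    using assms by (auto simp: place_def valid_core_def valid_item_def)
qed

text \<open>Every surviving entry is a child of an earlier one, and placing an item preserves
  validity. \<open>X\<close> collects the jobs placed before, which frees the induction from the
  initial table.\<close>

lemma dp_sound:
  assumes "u > 0" "e \<in> set (fold (dp_step L D u) its es)" "decreasing its"
    "\<And>it. it \<in> set its \<Longrightarrow> valid_item it"
    "\<And>e c. e \<in> set es \<Longrightarrow> c \<in> set e \<Longrightarrow> valid_core u its c"
    "\<And>e c. e \<in> set es \<Longrightarrow> c \<in> set e \<Longrightarrow> fst c \<le> L"
    "\<And>e. e \<in> set es \<Longrightarrow> length e = n"
    "\<And>e. e \<in> set es \<Longrightarrow> mset (concat (map ids e)) = X"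
  shows "(\<forall>c\<in>set e. valid_core u [] c \<and> fst c \<le> L) \<and> length e = n \<and>
    mset (concat (map ids e)) = X + mset (concat (map ids its))"
  using assms(2-)
proof (induction its arbitrary: es X)
  case (Cons it its)
  have step: "length e = n \<and> (\<forall>c\<in>set e. valid_core u its c \<and> fst c \<le> L) \<and>
      mset (concat (map ids e)) = X + mset (ids it)"
    if e: "e \<in> set (dp_step L D u it es)" for e
  proof -
    obtain e' where e': "e' \<in> set es" "e \<in> set (children L u it e')"
      by (rule dp_step_children[OF e])
    then obtain i where i: "e = e'[i := place u it (e' ! i)]" "i < length e'"
      unfolding children_eq by auto
    have v: "valid_core u (it # its) c" if "c \<in> set e'" for c
      using Cons.prems(4)[OF e'(1) that] .
    have "valid_core u its c" if "valid_core u (it # its) c" for c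
      using that by (auto simp: valid_core_def)
    moreover have "valid_core u its (place u it (e' ! i))"
      using Cons.prems(2,3) v i(2) by (intro valid_place assms(1)) auto
    moreover have "set e \<subseteq> insert (place u it (e' ! i)) (set e')"
      unfolding i(1) by (rule set_update_subset_insert)
    ultimately have "\<forall>c\<in>set e. valid_core u its c"
      using v by blast
    moreover have "mset (concat (map ids e)) = X + mset (ids it)"
      using mset_concat_list_update[OF i(2), of "place u it (e' ! i)"] Cons.prems(7)[OF e'(1)]
      by (simp add: i(1) place_def)
    ultimately show ?thesis
      using sz_children(1,2)[OF e'(2)] Cons.prems(6)[OF e'(1)] by (auto simp: list_all_iff)
  qed
  have "(\<forall>c\<in>set e. valid_core u [] c \<and> fst c \<le> L) \<and> length e = n \<and>
    mset (concat (map ids e)) = (X + mset (ids it)) + mset (concat (map ids its))"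
    by (rule Cons.IH[of "dp_step L D u it es"]) (use Cons.prems step in auto)
  then show ?case
    by (simp add: ac_simps)
qed auto

end

section \<open>Completeness of the pruned table\<close>

text \<open>The order of the cores is forgotten, since cores of equal level offer the same room for
  later items.\<close>

definition dominates :: "int \<Rightarrow> core list \<Rightarrow> core list \<Rightarrow> bool" where
  "dominates D e e' \<longleftrightarrow> mset (map fst e) = mset (map fst e') \<and> cost D e \<le> cost D e'"

text \<open>The first item on a core overwrites its demand. With demand 0 on all idle cores this
  changes the cost of any two compared states by the same amount.\<close>

definition idle_zero :: "core list \<Rightarrow> bool" where
  "idle_zero e \<longleftrightarrow> (\<forall>c\<in>set e. fst c = 0 \<longrightarrow> dem c = 0)"

lemma idle_zero_place: "idle_zero e \<Longrightarrow> idle_zero (e[i := place u it c])"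
  using set_update_subset_insert[of e i "place u it c"]
  by (auto simp: idle_zero_def place_def weight_def)

lemma idle_zero_dp_step:
  assumes "\<And>e. e \<in> set es \<Longrightarrow> idle_zero e" "e \<in> set (dp_step L D u it es)"
  shows "idle_zero e"
proof -
  obtain e' where "e' \<in> set es" "e \<in> set (children L u it e')"
    by (rule dp_step_children[OF assms(2)])
  then obtain i where "e = e'[i := place u it (e' ! i)]" "idle_zero e'"
    using assms(1) by (auto simp: children_eq)
  then show ?thesis
    using idle_zero_place by simp
qed

lemma level_counts_mset:
  assumes "\<forall>c\<in>set e. fst c \<le> L" "\<forall>c\<in>set e'. fst c \<le> L" "level_counts L e = level_counts L e'"
  shows "mset (map fst e) = mset (map fst e')"
proof (rule multiset_eqI)
  have c: "count (mset (map fst e)) k = length (filter (\<lambda>c. fst c = k) e)" for e :: "core list" and k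
    by (induction e) auto
  show "count (mset (map fst e)) k = count (mset (map fst e')) k" for k
  proof (cases "k \<le> L")
    case True
    then show ?thesis
      using assms(3) unfolding c by (auto simp: level_counts_def)
  next
    case False
    then have "filter (\<lambda>c. fst c = k) e = []" "filter (\<lambda>c. fst c = k) e' = []"
      using assms(1,2) by (auto simp: filter_empty_conv)
    then show ?thesis
      unfolding c by simp
  qed
qed

text \<open>An entry is discarded only in favour of one with the same level counts and no larger
  cost.\<close>

lemma add_entry_complete:
  "e \<in> set cs \<union> set es \<Longrightarrow> \<exists>e'\<in>set (fold (add_entry L D) cs es).
    level_counts L e' = level_counts L e \<and> cost D e' \<le> cost D e"
proof (induction cs arbitrary: es e)
  case (Cons c cs)
  have "\<exists>e'\<in>set cs \<union> set (add_entry L D c es). level_counts L e' = level_counts L e \<and> cost D e' \<le> cost D e"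
  proof (cases "e \<in> set cs")
    case False
    then have "e = c \<or> e \<in> set es"
      using Cons.prems by auto
    then show ?thesis
      by (force simp: add_entry_def same_levels_iff list_ex_iff)
  qed auto
  then obtain e' where e': "e' \<in> set cs \<union> set (add_entry L D c es)"
    "level_counts L e' = level_counts L e" "cost D e' \<le> cost D e"
    by blast
  from Cons.IH[OF e'(1)] e'(2,3) show ?case
    by fastforce
qed auto

text \<open>The move of \<open>f\<close> is imitated on a core of \<open>e\<close> with the same
  level. Either both cores are idle and both costs rise by the demand of the item, or both are in
  use and neither cost changes.\<close>

lemma children_dominate:
  assumes "dominates D e f" "idle_zero e" "idle_zero f" "i < length f"
    "\<forall>c\<in>set (f[i := place u it (f ! i)]). fst c \<le> L"
  shows "\<exists>e'\<in>set (children L u it e). dominates D e' (f[i := place u it (f ! i)])"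
proof -
  have m: "mset (map fst e) = mset (map fst f)"
    using assms(1) by (simp add: dominates_def)
  have "fst (f ! i) \<in> set (map fst f)"
    using assms(4) by auto
  then have "fst (f ! i) \<in> set (map fst e)"
    using mset_eq_setD[OF m] by simp
  then obtain k where k: "k < length e" "fst (e ! k) = fst (f ! i)"
    by (auto simp: in_set_conv_nth)
  define e' where "e' = e[k := place u it (e ! k)]"
  define f' where "f' = f[i := place u it (f ! i)]"
  have m': "mset (map fst e') = mset (map fst f')"
    using k assms(4) m by (simp add: e'_def f'_def map_update mset_update place_def)
  have "fst ` set e' = fst ` set f'"
    using mset_eq_setD[OF m'] by simp
  then have "\<forall>l\<in>fst ` set e'. l \<le> L"
    using assms(5) by (simp add: f'_def)
  then have "list_all (\<lambda>c. fst c \<le> L) e'"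
    by (simp add: list_all_iff)
  then have "e' \<in> set (children L u it e)"
    using k(1) by (auto simp: children_eq e'_def)
  moreover have "fst (e ! k) = 0 \<longrightarrow> dem (e ! k) = 0" "fst (f ! i) = 0 \<longrightarrow> dem (f ! i) = 0"
    using assms(2-4) k(1) by (simp_all add: idle_zero_def)
  then have "cost D e' \<le> cost D f'"
    using assms(1,4) k by (auto simp: e'_def f'_def cost_list_update dominates_def place_def)
  ultimately show ?thesis
    using m' by (auto simp: dominates_def f'_def)
qed

text \<open>The run of a prescribed assignment, which the table has to match step by step.\<close>

definition place_all :: "int \<Rightarrow> (item \<times> nat) list \<Rightarrow> core list \<Rightarrow> core list" where
  "place_all u ps e = fold (\<lambda>(it, i) e. e[i := place u it (e ! i)]) ps e"

lemma place_all_simps [simp]: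
  "place_all u [] e = e"
  "place_all u ((it, i) # ps) e = place_all u ps (e[i := place u it (e ! i)])"
  by (simp_all add: place_all_def)

lemma length_place_all [simp]: "length (place_all u ps e) = length e"
  by (induction ps arbitrary: e) auto

lemma level_place_all:
  "i < length e \<Longrightarrow> fst (place_all u ps e ! i) =
    fst (e ! i) + sum_list (map (\<lambda>(it, k). if k = i then weight u it else 0) ps)"
  by (induction ps arbitrary: e) (auto simp: nth_list_update place_def)

lemma demand_place_all:
  "i < length e \<Longrightarrow> Q (dem (e ! i)) \<Longrightarrow> (\<And>it. (it, i) \<in> set ps \<Longrightarrow> Q (dem it)) \<Longrightarrow>
    Q (dem (place_all u ps e ! i))"
proof (induction ps arbitrary: e)
  case (Cons p ps)
  obtain it k where p: "p = (it, k)"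
    by (cases p)
  have "Q (dem (e[k := place u it (e ! k)] ! i))"
    using Cons.prems(1,2) Cons.prems(3)[of it] p by (cases "k = i") (auto simp: place_def)
  then show ?case
    using Cons.IH[of "e[k := place u it (e ! k)]"] Cons.prems by (simp add: p)
qed simp

text \<open>Pruning may remove the states of the prescribed run, but a dominating entry stays, and
  dominance carries over to the next placement.\<close>

lemma dp_complete:
  assumes "dominates D e f" "e \<in> set es" "\<And>e. e \<in> set es \<Longrightarrow> idle_zero e" "idle_zero f"
    "\<And>it i. (it, i) \<in> set ps \<Longrightarrow> i < length f" "\<forall>c\<in>set (place_all u ps f). fst c \<le> L"
  shows "\<exists>e'\<in>set (fold (dp_step L D u) (map fst ps) es). dominates D e' (place_all u ps f)"
  using assms
proof (induction ps arbitrary: e f es)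
  case (Cons p ps)
  obtain it i where p: "p = (it, i)"
    by (cases p)
  define f' where "f' = f[i := place u it (f ! i)]"
  have i: "i < length f"
    using Cons.prems(5)[of it i] p by simp
  \<comment> \<open>Levels never decrease, so the bound at the end of the run holds already now and
    the child is not filtered out.\<close>
  have le: "\<forall>c\<in>set f'. fst c \<le> L"
  proof
    fix c
    assume "c \<in> set f'"
    then obtain k where k: "k < length f'" "c = f' ! k"
      by (auto simp: in_set_conv_nth)
    have "place_all u ps f' ! k \<in> set (place_all u ps f')"
      using k by simp
    then have "fst (place_all u ps f' ! k) \<le> L"
      using Cons.prems(6) by (simp add: p f'_def)
    then show "fst c \<le> L"
      using level_place_all[OF k(1), of u ps] k by simp
  qed
  obtain e1 where e1: "e1 \<in> set (children L u it e)" "dominates D e1 f'"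
    using children_dominate[OF Cons.prems(1) Cons.prems(3)[OF Cons.prems(2)] Cons.prems(4) i] le
    unfolding f'_def by blast
  have "e1 \<in> set (concat (map (children L u it) es)) \<union> set []"
    using e1(1) Cons.prems(2) by auto
  from add_entry_complete[OF this] obtain e2 where e2: "e2 \<in> set (dp_step L D u it es)"
    "level_counts L e2 = level_counts L e1" "cost D e2 \<le> cost D e1"
    unfolding dp_step_def by blast
  obtain e3 where e3: "e2 \<in> set (children L u it e3)"
    by (rule dp_step_children[OF e2(1)])
  have "mset (map fst e2) = mset (map fst e1)"
    by (rule level_counts_mset[OF _ _ e2(2)])
      (use sz_children(2)[OF e3] sz_children(2)[OF e1(1)] in \<open>auto simp: list_all_iff\<close>)
  then have "dominates D e2 f'"
    using e1(2) e2(3) by (auto simp: dominates_def)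
  moreover have "i < length f'" if "(it, i) \<in> set ps" for it i
    using Cons.prems(5)[of it i] that by (simp add: f'_def)
  moreover have "idle_zero f'"
    unfolding f'_def by (rule idle_zero_place[OF Cons.prems(4)])
  moreover have "\<forall>c\<in>set (place_all u ps f'). fst c \<le> L"
    using Cons.prems(6) by (simp add: p f'_def)
  ultimately have "\<exists>e'\<in>set (fold (dp_step L D u) (map fst ps) (dp_step L D u it es)).
      dominates D e' (place_all u ps f')"
    using idle_zero_dp_step[OF Cons.prems(3)] by (intro Cons.IH[OF _ e2(1)])
  then show ?case
    by (simp add: p f'_def)
qed auto

section \<open>Bundling small jobs\<close>

lemma mset_insert_item: "mset (insert_item it xs) = add_mset it (mset xs)"
  by (simp add: insert_item_def)

lemma decreasing_insert_item: "decreasing xs \<Longrightarrow> decreasing (insert_item it xs)"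
  by (auto simp: insert_item_def sorted_wrt_append intro: sorted_wrt_filter)

lemma sort_items_snoc: "sort_items (xs @ [x]) = insert_item x (sort_items xs)"
  by (simp add: sort_items_def)

lemma mset_sort_items [simp]: "mset (sort_items xs) = mset xs"
  by (induction xs rule: rev_induct)
    (simp_all add: sort_items_snoc mset_insert_item, simp add: sort_items_def)

lemma set_sort_items [simp]: "set (sort_items xs) = set xs"
  by (metis mset_sort_items set_mset_mset)

lemma decreasing_sort_items: "decreasing (sort_items xs)"
  by (induction xs rule: rev_induct)
    (simp_all add: sort_items_snoc decreasing_insert_item, simp add: sort_items_def)

text \<open>A bundle remembered as the list of its items: bundling cuts the sorted list into
  consecutive groups.\<close>

definition join :: "item list \<Rightarrow> item" where
  "join g = (sum_list (map fst g), dem (hd g), concat (map ids g))"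

text \<open>The last bundle, which may be too light, is the head of the list.\<close>

lemma bundles_groups:
  assumes "\<And>it. it \<in> set xs \<Longrightarrow> 0 < fst it \<and> fst it < h"
  shows "\<exists>gs. concat (rev gs) = xs \<and> [] \<notin> set gs \<and> bundles h xs = map join gs \<and>
    (\<forall>g\<in>set gs. sum_list (map fst g) \<le> 2 * h) \<and> (\<forall>g\<in>set (tl gs). h \<le> sum_list (map fst g))"
  using assms
proof (induction xs rule: rev_induct)
  case Nil
  show ?case
    by (rule exI[of _ "[]"]) (simp add: bundles_def)
next
  case (snoc x xs)
  then obtain gs where gs: "concat (rev gs) = xs" "[] \<notin> set gs" "bundles h xs = map join gs"
    "\<forall>g\<in>set gs. sum_list (map fst g) \<le> 2 * h" "\<forall>g\<in>set (tl gs). h \<le> sum_list (map fst g)"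
    by auto
  have x: "0 < fst x" "fst x < h"
    using snoc.prems[of x] by auto
  have b: "bundles h (xs @ [x]) = bundle_step h x (map join gs)"
    using gs(3) by (simp add: bundles_def)
  have single: "join [x] = x"
    by (simp add: join_def)
  show ?case
  proof (cases gs)
    case Nil
    then show ?thesis
      using x gs(1) b single by (intro exI[of _ "[[x]]"]) (simp add: bundle_step_def)
  next
    case (Cons g gs')
    show ?thesis
    proof (cases "h \<le> sum_list (map fst g)")
      case True
      then show ?thesis
        using x gs b single Cons
        by (intro exI[of _ "[x] # gs"]) (auto simp: bundle_step_def join_def)
    next
      case False
      have "merge (join g) x = join (g @ [x])"
        using gs(2) Cons by (cases g) (auto simp: merge_def join_def)
      \<comment> \<open>The group was below \<open>h\<close> and gains an item below
        \<open>h\<close>; this is the origin of the bound \<open>2 * h\<close>.\<close>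
      then show ?thesis
        using x gs b Cons False
        by (intro exI[of _ "(g @ [x]) # gs'"]) (auto simp: bundle_step_def join_def)
    qed
  qed
qed

lemma mset_ids_cong: "mset xs = mset ys \<Longrightarrow> mset (concat (map ids xs)) = mset (concat (map ids ys))"
  by (simp add: mset_concat flip: sum_mset_sum_list)

lemma concat_ids_join: "concat (map ids (map join gs)) = concat (map ids (concat gs))"
  by (induction gs) (auto simp: join_def)

lemma mset_ids_filter:
  "mset (concat (map ids (filter Q xs))) + mset (concat (map ids (filter (\<lambda>x. \<not> Q x) xs))) =
    mset (concat (map ids xs))"
  by (induction xs) (auto simp: ac_simps)

context job_data
begin

lemma valid_join:
  assumes "\<And>it. it \<in> set g \<Longrightarrow> valid_item it" "decreasing g" "g \<noteq> []"
  shows "valid_item (join g)"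
proof -
  have "dem it \<le> dem (hd g)" if "it \<in> set g" for it
    using assms(2,3) that by (cases g) auto
  moreover have "sum_list (map fst g) = sum_list (map A (concat (map ids g)))"
    using assms(1) by (induction g) (auto simp: valid_item_def)
  moreover have "Q (dem (hd g))"
    using assms(1)[of "hd g"] assms(3) by (simp add: valid_item_def)
  moreover have "R j \<le> dem (hd g)" if "it \<in> set g" "j \<in> set (ids it)" for j it
    using assms(1)[OF that(1)] that(2) calculation(1)[OF that(1)]
    by (auto simp: valid_item_def intro: order_trans)
  ultimately show ?thesis
    by (auto simp: valid_item_def join_def)
qed

lemma pack_valid:
  assumes "\<And>it. it \<in> set xs \<Longrightarrow> valid_item it \<and> 0 < fst it"
  shows "decreasing (pack h xs)" "mset (concat (map ids (pack h xs))) = mset (concat (map ids xs))"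
    "\<And>it. it \<in> set (pack h xs) \<Longrightarrow> valid_item it"
proof -
  let ?small = "filter (\<lambda>it. fst it < h) xs" and ?big = "filter (\<lambda>it. h \<le> fst it) xs"
  obtain gs where gs: "concat (rev gs) = sort_items ?small" "[] \<notin> set gs"
    "bundles h (sort_items ?small) = map join gs"
    using bundles_groups[of "sort_items ?small" h] assms by auto
  show "decreasing (pack h xs)"
    unfolding pack_def by (rule decreasing_sort_items)
  have "mset (concat (map ids (map join gs))) = mset (concat (map ids (concat (rev gs))))"
    unfolding concat_ids_join by (rule mset_ids_cong) (simp add: mset_concat flip: rev_map)
  also have "\<dots> = mset (concat (map ids ?small))"
    unfolding gs(1) by (rule mset_ids_cong) simp
  finally have "mset (concat (map ids (?big @ map join gs))) = mset (concat (map ids xs))"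
    using mset_ids_filter[of "\<lambda>it. h \<le> fst it" xs] by (simp add: not_le)
  moreover have "mset (concat (map ids (pack h xs))) = mset (concat (map ids (?big @ map join gs)))"
    unfolding pack_def gs(3) by (rule mset_ids_cong) simp
  ultimately show "mset (concat (map ids (pack h xs))) = mset (concat (map ids xs))"
    by simp
  fix it
  assume "it \<in> set (pack h xs)"
  then consider "it \<in> set xs" | g where "g \<in> set gs" "it = join g"
    unfolding pack_def gs(3) by auto
  then show "valid_item it"
  proof cases
    case 2
    \<comment> \<open>A group is a contiguous piece of the sorted list, hence sorted itself, and its
      first demand is its largest.\<close>
    then obtain as bs where "rev gs = as @ g # bs"
      by (metis set_rev split_list)
    then have s: "sort_items ?small = concat as @ g @ concat bs"
      using gs(1) by simp
    then have "decreasing g"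
      using decreasing_sort_items[of ?small] by (simp add: sorted_wrt_append)
    moreover have "set g \<subseteq> set xs"
      using arg_cong[OF s, of set] by auto
    ultimately show ?thesis
      using 2 gs(2) assms by (auto intro!: valid_join)
  qed (use assms in auto)
qed

end

section \<open>Refilling the cores with bundles\<close>

text \<open>\<open>C i\<close> is the load that the given assignment puts on the first \<open>i\<close> cores, and job \<open>t\<close> is moved to the
  core \<open>i\<close> for which the load preceding \<open>t\<close> falls into \<open>[C i, C (i + 1))\<close>.  If its demand exceeded
  the cache of that core, then all jobs up to \<open>t\<close> would have been assigned to the first \<open>i\<close> cores.\<close>

lemma first_fit:
  fixes l :: "nat \<Rightarrow> int" and d p :: "nat \<Rightarrow> real"
  assumes job: "\<And>j. j < n \<Longrightarrow> 0 < l j \<and> \<kappa> j < N \<and> d j \<le> p (\<kappa> j)"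
    and d: "\<And>j j'. j \<le> j' \<Longrightarrow> j' < n \<Longrightarrow> d j' \<le> d j"
    and p: "\<And>i i'. i \<le> i' \<Longrightarrow> i' < N \<Longrightarrow> p i' \<le> p i"
    and t: "t < n"
  defines "C \<equiv> \<lambda>i. \<Sum>j | j < n \<and> \<kappa> j < i. l j"
  shows "\<exists>i<N. C i \<le> (\<Sum>j<t. l j) \<and> (\<Sum>j<t. l j) < C (Suc i) \<and> d t \<le> p i"
proof -
  let ?P = "\<Sum>j<t. l j"
  have upto: "(\<Sum>j<Suc t. l j) \<le> C i" if "\<And>j. j \<le> t \<Longrightarrow> \<kappa> j < i" for i
    unfolding C_def using that t job by (intro sum_mono2) (auto simp: less_Suc_eq_le less_imp_le)
  have lt: "?P < (\<Sum>j<Suc t. l j)"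
    using job[OF t] by simp
  have "N \<noteq> 0"
    using job[OF t] by auto
  have "?P < C (Suc (N - 1))"
    using upto[of N] job t lt \<open>N \<noteq> 0\<close> by fastforce
  define i where "i = (LEAST i. ?P < C (Suc i))"
  have i: "?P < C (Suc i)"
    unfolding i_def by (rule LeastI) fact
  have "i \<le> N - 1"
    unfolding i_def by (rule Least_le) fact
  then have "i < N"
    using \<open>N \<noteq> 0\<close> by simp
  have Ci: "C i \<le> ?P"
  proof (cases i)
    case 0
    have "0 \<le> ?P"
      using job t by (intro sum_nonneg) (simp add: less_imp_le)
    then show ?thesis
      using 0 by (simp add: C_def)
  next
    case (Suc k)
    then have "\<not> ?P < C (Suc k)"
      using not_less_Least[of k "\<lambda>i. ?P < C (Suc i)"] by (simp add: i_def)
    then show ?thesis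
      using Suc by simp
  qed
  have "d t \<le> p i"
  proof (rule ccontr)
    assume "\<not> d t \<le> p i"
    then have "\<kappa> j < i" if "j \<le> t" for j
      using job[of j] d[OF that t] p[of i "\<kappa> j"] that t by (meson le_less_trans not_le order_trans)
    then show False
      using upto[of i] lt Ci by simp
  qed
  then show ?thesis
    using i Ci \<open>i < N\<close> by blast
qed

text \<open>Consecutive intervals that start in \<open>[a, b)\<close> exceed it by at most the length of the last one.\<close>

lemma interval_load:
  fixes ls :: "int list"
  assumes "\<And>l. l \<in> set ls \<Longrightarrow> 0 \<le> l \<and> l \<le> M" "a \<le> b" "0 \<le> M"
  shows "(\<Sum>q<length ls. if a \<le> P + sum_list (take q ls) \<and> P + sum_list (take q ls) < b then ls ! q else 0)
    \<le> (if b \<le> P then 0 else b - max a P + M)"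
  using assms
proof (induction ls arbitrary: P)
  case (Cons l ls)
  have "(\<Sum>q<length ls. if a \<le> (P + l) + sum_list (take q ls) \<and> (P + l) + sum_list (take q ls) < b
      then ls ! q else 0) \<le> (if b \<le> P + l then 0 else b - max a (P + l) + M)"
    using Cons.prems by (intro Cons.IH) auto
  moreover have "0 \<le> l" "l \<le> M"
    using Cons.prems(1) by auto
  ultimately show ?case
    using Cons.prems(2,3) by (simp add: sum.lessThan_Suc_shift add.assoc max_def del: sum.lessThan_Suc cong: if_cong split: if_splits)
qed simp

abbreviation core_load :: "(item \<times> nat) list \<Rightarrow> nat \<Rightarrow> int" where
  "core_load ps i \<equiv> sum_list (map (\<lambda>(it, k). if k = i then fst it else 0) ps)"

text \<open>A bundle goes to the core in whose slot \<open>[C i, C (i + 1))\<close> its first item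
  starts; since its demand is that of this item, \<open>first_fit\<close> shows that the cache
  suffices. A slot is as long as the old load of the core, and the last bundle starting in it
  overhangs by at most \<open>2 * h\<close>. Only the bundle filled last can be lighter than
  \<open>h\<close>, which gives the final bound.\<close>

lemma bundles_assignment:
  fixes p :: "nat \<Rightarrow> real" and h :: int
  assumes pair: "\<And>it i. (it, i) \<in> set ps \<Longrightarrow> 0 < fst it \<and> fst it < h \<and> i < N \<and> of_rat (dem it) \<le> p i"
    and dec: "decreasing (map fst ps)"
    and p: "\<And>i i'. i \<le> i' \<Longrightarrow> i' < N \<Longrightarrow> p i' \<le> p i"
    and h: "0 < h"
  shows "\<exists>qs. mset (map fst qs) = mset (bundles h (map fst ps)) \<and>
    (\<forall>(it, i)\<in>set qs. 0 \<le> fst it \<and> i < N \<and> of_rat (dem it) \<le> p i) \<and>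
    (\<forall>i<N. core_load qs i \<le> core_load ps i + 2 * h) \<and>
    sum_list (map (\<lambda>(it, i). if fst it < h then h else 0) qs) \<le> h"
proof -
  define xs where "xs = map fst ps"
  define n where "n = length ps"
  define C where "C = (\<lambda>i. \<Sum>j | j < n \<and> snd (ps ! j) < i. fst (xs ! j))"
  have xs: "0 < fst it \<and> fst it < h" if "it \<in> set xs" for it
    using that pair by (auto simp: xs_def)
  obtain gs where gs: "concat (rev gs) = xs" "[] \<notin> set gs" "bundles h xs = map join gs"
    "\<forall>g\<in>set gs. sum_list (map fst g) \<le> 2 * h" "\<forall>g\<in>set (tl gs). h \<le> sum_list (map fst g)"
    using bundles_groups[OF xs] by blast
  define gss where "gss = rev gs"
  define t where "t q = length (concat (take q gss))" for q
  have fit: "\<exists>i<N. C i \<le> (\<Sum>j<t. fst (xs ! j)) \<and> (\<Sum>j<t. fst (xs ! j)) < C (Suc i) \<and>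
      of_rat (dem (xs ! t)) \<le> p i" if "t < n" for t
    unfolding C_def
  proof (rule first_fit[where d = "\<lambda>j. of_rat (dem (xs ! j))"])
    show "0 < fst (xs ! j) \<and> snd (ps ! j) < N \<and> of_rat (dem (xs ! j)) \<le> p (snd (ps ! j))"
      if "j < n" for j
      using pair[of "fst (ps ! j)" "snd (ps ! j)"] that by (simp add: xs_def n_def)
    show "of_rat (dem (xs ! j')) \<le> (of_rat (dem (xs ! j)) :: real)" if "j \<le> j'" "j' < n" for j j'
      using that dec by (cases "j = j'")
        (auto simp: xs_def n_def of_rat_less_eq sorted_wrt_iff_nth_less)
  qed (use p that in auto)
  \<comment> \<open>Translates between the two lists: \<open>t q\<close> is the position of the
    first item of bundle \<open>q\<close>, and the load before it is the total of the preceding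
    bundles.\<close>
  have group: "t q < n \<and> xs ! t q = hd (gss ! q) \<and>
      (\<Sum>j<t q. fst (xs ! j)) = sum_list (take q (map (\<lambda>g. sum_list (map fst g)) gss))"
    if q: "q < length gss" for q
  proof -
    have "gss = take q gss @ gss ! q # drop (Suc q) gss"
      by (rule id_take_nth_drop[OF q])
    then have x: "xs = concat (take q gss) @ gss ! q @ concat (drop (Suc q) gss)"
      using gs(1) unfolding gss_def[symmetric] by (metis concat.simps(2) concat_append)
    have "gss ! q \<noteq> []"
      using gs(2) q nth_mem[OF q] by (auto simp: gss_def)
    moreover have "length xs = n"
      by (simp add: xs_def n_def)
    ultimately have "t q < n \<and> xs ! t q = hd (gss ! q)"
      using x by (auto simp: t_def nth_append hd_conv_nth)
    moreover have "(\<Sum>j<t q. fst (xs ! j)) = (\<Sum>j<t q. map fst (concat (take q gss)) ! j)"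
      using x by (intro sum.cong) (auto simp: t_def nth_append)
    moreover have "\<dots> = sum_list (map fst (concat (take q gss)))"
      by (simp add: sum_list_sum_nth t_def atLeast0LessThan)
    moreover have "sum_list (map fst (concat hs)) = sum_list (map (\<lambda>g. sum_list (map fst g)) hs)"
      for hs :: "item list list"
      by (induction hs) auto
    ultimately show ?thesis
      by (simp add: take_map)
  qed
  define ls where "ls = map (\<lambda>g. sum_list (map fst g)) gss"
  have "\<exists>i<N. C i \<le> sum_list (take q ls) \<and> sum_list (take q ls) < C (Suc i) \<and>
      of_rat (dem (join (gss ! q))) \<le> p i" if "q < length gss" for q
    using group[OF that] fit[of "t q"] by (simp add: join_def ls_def)
  then obtain \<kappa> where \<kappa>: "\<And>q. q < length gss \<Longrightarrow> \<kappa> q < N \<and> C (\<kappa> q) \<le> sum_list (take q ls) \<and>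
      sum_list (take q ls) < C (Suc (\<kappa> q)) \<and> of_rat (dem (join (gss ! q))) \<le> p (\<kappa> q)"
    by metis
  define qs where "qs = map (\<lambda>q. (join (gss ! q), \<kappa> q)) [0..<length gss]"
  have fst_qs: "map fst qs = map join gss"
    by (rule nth_equalityI) (auto simp: qs_def)
  have nonneg: "0 \<le> fst (join g) \<and> fst (join g) \<le> 2 * h" if g: "g \<in> set gss" for g
  proof -
    have "set g \<subseteq> set xs"
      using g gs(1) by (auto simp: gss_def)
    then have "0 \<le> x" if "x \<in> set (map fst g)" for x
      using that xs by fastforce
    then have "0 \<le> sum_list (map fst g)"
      by (intro sum_list_nonneg) blast
    then show ?thesis
      using gs(4) g by (simp add: join_def gss_def)
  qed
  have "mset (map fst qs) = mset (bundles h xs)"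
    unfolding fst_qs gs(3) by (simp add: gss_def)
  moreover have "\<forall>(it, i)\<in>set qs. 0 \<le> fst it \<and> i < N \<and> of_rat (dem it) \<le> p i"
    using \<kappa> nonneg by (auto simp: qs_def)
  moreover have "core_load qs i \<le> core_load ps i + 2 * h" if "i < N" for i
  proof -
    have len: "length ls = length gss"
      by (simp add: ls_def)
    have ls: "0 \<le> l \<and> l \<le> 2 * h" if "l \<in> set ls" for l
      using that nonneg by (auto simp: ls_def join_def)
    have C_le: "C i \<le> C (Suc i)"
      unfolding C_def using xs by (intro sum_mono2) (auto simp: xs_def n_def less_imp_le)
    have "core_load qs i = (\<Sum>q<length gss. if \<kappa> q = i then ls ! q else 0)"
      by (simp add: qs_def ls_def join_def interv_sum_list_conv_sum_set_nat atLeast0LessThan o_def)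
        (auto intro!: sum.cong simp: ls_def)
    also have "\<dots> \<le> (\<Sum>q<length gss. if C i \<le> 0 + sum_list (take q ls) \<and> 0 + sum_list (take q ls) < C (Suc i)
        then ls ! q else 0)"
      using \<kappa> ls len by (intro sum_mono) auto
    also have "\<dots> \<le> (if C (Suc i) \<le> 0 then 0 else C (Suc i) - max (C i) 0 + 2 * h)"
      using interval_load[of ls "2 * h" "C i" "C (Suc i)" 0] ls C_le h by (simp add: len)
    also have "\<dots> \<le> C (Suc i) - C i + 2 * h"
      using C_le h by auto
    also have "C (Suc i) = C i + core_load ps i"
    proof -
      have "{j. j < n \<and> snd (ps ! j) < Suc i} = {j. j < n \<and> snd (ps ! j) < i} \<union> {j. j < n \<and> snd (ps ! j) = i}"
        by auto
      then have "C (Suc i) = C i + (\<Sum>j | j < n \<and> snd (ps ! j) = i. fst (xs ! j))"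
        unfolding C_def by (simp, intro sum.union_disjoint) auto
      also have "(\<Sum>j | j < n \<and> snd (ps ! j) = i. fst (xs ! j)) = core_load ps i"
        by (simp add: sum_list_sum_nth n_def xs_def split_beta atLeast0LessThan sum.If_cases lessThan_def Int_def)
      finally show ?thesis .
    qed
    finally show ?thesis by simp
  qed
  moreover have "sum_list (map (\<lambda>(it, i). if fst it < h then h else 0) qs) \<le> h"
  proof -
    have "sum_list (map (\<lambda>(it, i). if fst it < h then h else 0) qs) =
        sum_list (map (\<lambda>it. if fst it < h then h else 0) (map fst qs))"
      by (simp add: o_def case_prod_unfold)
    also have "\<dots> = sum_list (map (\<lambda>g. if fst (join g) < h then h else 0) gs)"
      unfolding fst_qs gss_def by (simp add: o_def rev_map sum_list_rev flip: rev_map)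
    also have "\<dots> \<le> h"
    proof (cases gs)
      case (Cons g gs')
      have "map (\<lambda>g. if fst (join g) < h then h else 0) gs' = map (\<lambda>g. 0) gs'"
        using gs(5) Cons by (auto simp: join_def)
      then have "sum_list (map (\<lambda>g. if fst (join g) < h then h else 0) gs') = 0"
        by (simp only: sum_list_0)
      then show ?thesis
        using Cons h by simp
    qed (use h in simp)
    finally show ?thesis .
  qed
  ultimately show ?thesis
    unfolding xs_def by blast
qed

text \<open>Lets an assignment follow its items through sorting.\<close>

lemma reorder_pairs:
  assumes "mset (map fst ps) = mset xs"
  shows "\<exists>qs. map fst qs = xs \<and> mset qs = mset ps"
proof -
  obtain ys where "length ys = length xs" "mset (zip xs ys) = mset (zip (map fst ps) (map snd ps))"
    using ex_mset_zip_left[of "map fst ps" "map snd ps" xs] assms by auto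
  then show ?thesis
    by (intro exI[of _ "zip xs ys"]) (simp add: zip_map_fst_snd)
qed

lemma sum_list_mset_cong: "mset xs = mset ys \<Longrightarrow> sum_list (map f xs) = (sum_list (map f ys) :: int)"
  by (metis mset_map sum_mset_sum_list)

text \<open>Big items keep their cores, so only the small ones pass through
  \<open>bundles_assignment\<close> and cause overload.\<close>

lemma pack_assignment:
  fixes p :: "nat \<Rightarrow> real" and h :: int
  assumes pair: "\<And>it i. (it, i) \<in> set ps \<Longrightarrow> 0 < fst it \<and> i < N \<and> of_rat (dem it) \<le> p i"
    and p: "\<And>i i'. i \<le> i' \<Longrightarrow> i' < N \<Longrightarrow> p i' \<le> p i"
    and h: "0 < h"
  shows "\<exists>qs. map fst qs = pack h (map fst ps) \<and>
    (\<forall>(it, i)\<in>set qs. 0 \<le> fst it \<and> i < N \<and> of_rat (dem it) \<le> p i) \<and>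
    (\<forall>i<N. core_load qs i \<le> core_load ps i + 2 * h) \<and>
    sum_list (map (\<lambda>(it, i). if fst it < h then h else 0) qs) \<le> h"
proof -
  define small where "small = filter (\<lambda>q. fst (fst q) < h) ps"
  define big where "big = filter (\<lambda>q. h \<le> fst (fst q)) ps"
  have split: "core_load big i + core_load small i = core_load ps i" for i
    unfolding big_def small_def by (induction ps) auto
  have fsts: "filter (\<lambda>it. fst it < h) (map fst ps) = map fst small"
    "filter (\<lambda>it. h \<le> fst it) (map fst ps) = map fst big"
    by (simp_all add: small_def big_def filter_map o_def)
  obtain ss where ss: "map fst ss = sort_items (map fst small)" "mset ss = mset small"
    using reorder_pairs[of small "sort_items (map fst small)"] by auto
  have "\<exists>qs. mset (map fst qs) = mset (bundles h (map fst ss)) \<and>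
    (\<forall>(it, i)\<in>set qs. 0 \<le> fst it \<and> i < N \<and> of_rat (dem it) \<le> p i) \<and>
    (\<forall>i<N. core_load qs i \<le> core_load ss i + 2 * h) \<and>
    sum_list (map (\<lambda>(it, i). if fst it < h then h else 0) qs) \<le> h"
  proof (rule bundles_assignment[OF _ _ p h])
    show "0 < fst it \<and> fst it < h \<and> i < N \<and> of_rat (dem it) \<le> p i" if "(it, i) \<in> set ss" for it i
      using that pair[of it i] mset_eq_setD[OF ss(2)] by (auto simp: small_def)
    show "decreasing (map fst ss)"
      unfolding ss(1) by (rule decreasing_sort_items)
  qed
  then obtain bs where bs: "mset (map fst bs) = mset (bundles h (map fst ss))"
    "\<forall>(it, i)\<in>set bs. 0 \<le> fst it \<and> i < N \<and> of_rat (dem it) \<le> p i"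
    "\<forall>i<N. core_load bs i \<le> core_load ss i + 2 * h"
    "sum_list (map (\<lambda>(it, i). if fst it < h then h else 0) bs) \<le> h"
    by blast
  have "mset (map fst (big @ bs)) = mset (pack h (map fst ps))"
    using bs(1) by (simp add: pack_def fsts ss(1))
  then obtain qs where qs: "map fst qs = pack h (map fst ps)" "mset qs = mset (big @ bs)"
    using reorder_pairs by blast
  note sum_qs = sum_list_mset_cong[OF qs(2)] and sum_ss = sum_list_mset_cong[OF ss(2)]
  have "core_load qs i \<le> core_load ps i + 2 * h" if "i < N" for i
    using bs(3)[rule_format, OF that] split[of i] by (simp add: sum_qs sum_ss)
  moreover have "sum_list (map (\<lambda>(it, i). if fst it < h then h else 0) big) = 0"
    unfolding big_def by (induction ps) auto
  then have "sum_list (map (\<lambda>(it, i). if fst it < h then h else 0) qs) \<le> h"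
    using bs(4) by (simp add: sum_qs)
  moreover have "\<forall>(it, i)\<in>set qs. 0 \<le> fst it \<and> i < N \<and> of_rat (dem it) \<le> p i"
    using mset_eq_setD[OF qs(2)] bs(2) pair by (fastforce simp: big_def)
  ultimately show ?thesis
    using qs(1) by blast
qed

section \<open>The approximation guarantee\<close>

lemma denom_pos: "0 < snd (quotient_of r)"
  by (cases "quotient_of r") (simp add: quotient_of_denom_pos)

lemma scale_eq:
  assumes "snd (quotient_of r) dvd D"
  shows "of_int (scale D r) = of_int D * (of_rat r :: real)"
proof -
  obtain a b where ab: "quotient_of r = (a, b)"
    by (cases "quotient_of r")
  have r: "r = of_int a / of_int b" and b: "b > 0"
    using quotient_of_div[OF ab] quotient_of_denom_pos[OF ab] by auto
  obtain k where k: "D = b * k"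
    using assms ab by auto
  have "scale D r = a * k"
    using b by (simp add: scale_def ab k)
  moreover have "(of_rat r :: real) = of_int a / of_int b"
    by (simp add: r of_rat_divide)
  ultimately show ?thesis
    using b by (simp add: k)
qed

lemma level_bound:
  fixes m u :: int
  assumes "0 < m" "0 < u" "m * u * l \<le> (m + 1) * (m ^ 2 * u + 2 * (m * u)) + m * u"
  shows "l \<le> m ^ 2 + 3 * m + 3"
proof -
  have "(m + 1) * (m ^ 2 * u + 2 * (m * u)) + m * u = m * u * (m ^ 2 + 3 * m + 3)"
    by (simp add: algebra_simps power2_eq_square)
  then show ?thesis
    using assms by (simp add: mult_le_cancel_left_pos)
qed

text \<open>Rounding costs at most one unit, that is \<open>m * u\<close> after multiplication by
  \<open>m * u\<close>. A load of at least \<open>m * u\<close> absorbs this as one more copy of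
  itself; a lighter one is charged separately.\<close>

lemma weight_bound:
  assumes "0 < m" "0 < u" "0 \<le> fst it"
  shows "m * u * int (weight u it) \<le> (m + 1) * fst it + (if fst it < m * u then m * u else 0)"
proof -
  have "0 \<le> fst it div u"
    using assms by (simp add: pos_imp_zdiv_nonneg_iff)
  then have "m * u * int (weight u it) = m * (u * (fst it div u)) + m * u"
    by (simp add: weight_def algebra_simps)
  also have "u * (fst it div u) \<le> fst it"
    using mult_div_mod_eq[of u "fst it"] pos_mod_sign[OF assms(2), of "fst it"] by linarith
  then have "m * (u * (fst it div u)) \<le> m * fst it"
    using assms(1) by simp
  finally show ?thesis
    using assms(3) by (simp add: algebra_simps split: if_splits)
qed

text \<open>The first guess that succeeds comes no later than a guess known to succeed.\<close>

lemma hd_concat_map: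
  "k < length xs \<Longrightarrow> f (xs ! k) \<noteq> [] \<Longrightarrow> \<exists>i\<le>k. hd (concat (map f xs)) \<in> set (f (xs ! i))"
proof (induction xs arbitrary: k)
  case (Cons x xs)
  show ?case
  proof (cases "f x = []")
    case True
    then obtain k' where k': "k = Suc k'" "k' < length xs" "f (xs ! k') \<noteq> []"
      using Cons.prems by (cases k) auto
    then obtain i where "i \<le> k'" "hd (concat (map f xs)) \<in> set (f (xs ! i))"
      using Cons.IH by blast
    then show ?thesis
      using True k'(1) by (intro exI[of _ "Suc i"]) simp
  qed (auto intro!: exI[of _ 0])
qed simp

text \<open>Drop the unused cores and renumber the others by decreasing cache.\<close>

lemma normalize_solution:
  assumes "is_solution I p S" "0 \<le> M"
    and M: "\<And>i. i < cores I \<Longrightarrow> (\<Sum>j | j < num_jobs I \<and> S j = i. load I j) \<le> M"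
  defines "N \<equiv> min (cores I) (num_jobs I)"
  obtains p' S' where "\<And>j. j < num_jobs I \<Longrightarrow> S' j < N \<and> demand I j \<le> p' (S' j)"
    "\<And>i i'. i \<le> i' \<Longrightarrow> i' < N \<Longrightarrow> p' i' \<le> p' i" "\<And>i. 0 \<le> p' i"
    "(\<Sum>i<N. p' i) \<le> of_rat (cache I)"
    "\<And>i. (\<Sum>j | j < num_jobs I \<and> S' j = i. load I j) \<le> M"
proof -
  let ?n = "num_jobs I"
  define U where "U = S ` {..<?n}"
  have sol: "\<And>i. i < cores I \<Longrightarrow> 0 \<le> p i" "(\<Sum>i<cores I. p i) \<le> of_rat (cache I)"
    "\<And>j. j < ?n \<Longrightarrow> S j < cores I \<and> demand I j \<le> p (S j)"
    using assms(1) by (auto simp: is_solution_def)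
  have U: "finite U" "U \<subseteq> {..<cores I}"
    using sol(3) by (auto simp: U_def)
  define xs where "xs = sort_key (\<lambda>i. - p i) (sorted_list_of_set U)"
  have xs: "distinct xs" "set xs = U" "sorted (map (\<lambda>i. - p i) xs)"
    using U(1) by (simp_all add: xs_def)
  have "length xs \<le> N"
    using distinct_card[OF xs(1)] xs(2) card_mono[OF _ U(2)] card_image_le[of "{..<?n}" S]
    by (simp add: N_def U_def)
  define p' where "p' k = (if k < length xs then p (xs ! k) else 0)" for k
  have "\<exists>k<length xs. xs ! k = S j" if "j < ?n" for j
    using that xs(2) by (metis U_def imageI in_set_conv_nth lessThan_iff)
  then obtain S' where S': "\<And>j. j < ?n \<Longrightarrow> S' j < length xs \<and> xs ! S' j = S j"
    by metis
  show ?thesis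
  proof (rule that)
    show "S' j < N \<and> demand I j \<le> p' (S' j)" if "j < ?n" for j
      using S'[OF that] sol(3)[OF that] \<open>length xs \<le> N\<close> by (simp add: p'_def)
    have mem: "xs ! k < cores I" if "k < length xs" for k
      using that xs(2) U(2) nth_mem by blast
    then show "0 \<le> p' i" for i
      using sol(1) by (simp add: p'_def)
    show "p' i' \<le> p' i" if "i \<le> i'" "i' < N" for i i'
    proof (cases "i' < length xs")
      case True
      then show ?thesis
        using sorted_nth_mono[OF xs(3) that(1)] that by (simp add: p'_def)
    qed (use \<open>0 \<le> p' i\<close> in \<open>simp add: p'_def\<close>)
    have "(\<Sum>i<N. p' i) = (\<Sum>i<length xs. p (xs ! i))"
      using \<open>length xs \<le> N\<close> by (intro sum.mono_neutral_cong_right) (auto simp: p'_def)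
    also have "\<dots> = sum p U"
      using sum.distinct_set_conv_list[OF xs(1), of p] xs(2)
      by (simp add: sum_list_sum_nth atLeast0LessThan)
    also have "\<dots> \<le> (\<Sum>i<cores I. p i)"
      using U sol(1) by (intro sum_mono2) auto
    finally show "(\<Sum>i<N. p' i) \<le> of_rat (cache I)"
      using sol(2) by simp
    show "(\<Sum>j | j < ?n \<and> S' j = i. load I j) \<le> M" for i
    proof (cases "i < length xs")
      case True
      have "{j. j < ?n \<and> S' j = i} = {j. j < ?n \<and> S j = xs ! i}"
        using S' True xs(1) nth_eq_iff_index_eq by metis
      then show ?thesis
        using M mem[OF True] by simp
    next
      case False
      then have "{j. j < ?n \<and> S' j = i} = {}"
        using S' by auto
      then show ?thesis
        using assms(2) by (simp only: sum.empty)
    qed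
  qed
qed

lemma core_of:
  assumes "j \<in> set (concat (map ids e))"
  shows "core_of e j < length e" "j \<in> set (ids (e ! core_of e j))"
proof -
  obtain k where k: "k < length e" "j \<in> set (ids (e ! k))"
  proof -
    obtain c where "c \<in> set e" "j \<in> set (ids c)"
      using assms by auto
    then show ?thesis
      using that by (metis in_set_conv_nth)
  qed
  let ?xs = "filter (\<lambda>ic. j \<in> set (ids (snd ic))) (List.enumerate 0 e)"
  have "(k, e ! k) \<in> set ?xs"
    using k by (auto simp: in_set_enumerate_eq)
  then have "?xs \<noteq> []"
    by (metis empty_iff empty_set)
  then have "hd ?xs \<in> set ?xs"
    by (rule hd_in_set)
  then show "core_of e j < length e" "j \<in> set (ids (e ! core_of e j))"
    by (auto simp: core_of_def in_set_enumerate_eq)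
qed

section \<open>Guarantee for a single guess\<close>

locale approximation =
  fixes I :: problem and m :: nat
  assumes wf: "wf_problem I" and m: "0 < m"
begin

text \<open>All demands and loads become integers after multiplication by \<open>D\<close>, and \<open>A\<close> contains another factor
  \<open>m\<^sup>3\<close>.  A unit \<open>u = k * max_load\<close> thus stands for the makespan \<open>m\<^sup>2 * u\<close>, and consecutive
  units differ by a fraction of at most \<open>1 / m\<close> of the optimum.\<close>

definition inst :: inst where "inst = (jobs I, cores I, cache I)"

definition n :: nat where "n = num_jobs I"
definition N :: nat where "N = min (cores I) n"
definition D :: int where "D = denom inst"
definition A :: "nat \<Rightarrow> int" where "A j = int m ^ 3 * scale D (fst (jobs I ! j))"
definition R :: "nat \<Rightarrow> rat" where "R j = snd (jobs I ! j)"
definition Q :: "rat \<Rightarrow> bool" where "Q r \<longleftrightarrow> 0 \<le> r \<and> snd (quotient_of r) dvd D"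

sublocale job_data A R Q .

lemma D_pos: "0 < D"
proof -
  have "0 < prod_list (map (\<lambda>j. snd (quotient_of (fst j)) * snd (quotient_of (snd j))) js)"
    for js :: "(rat \<times> rat) list"
    by (induction js) (auto simp: denom_pos)
  then show ?thesis
    by (simp add: D_def denom_def denom_pos)
qed

lemma denom_dvd:
  "j < n \<Longrightarrow> snd (quotient_of (fst (jobs I ! j))) dvd D"
  "j < n \<Longrightarrow> snd (quotient_of (snd (jobs I ! j))) dvd D"
  "snd (quotient_of (cache I)) dvd D"
proof -
  let ?f = "\<lambda>j. snd (quotient_of (fst j)) * snd (quotient_of (snd j)) :: int"
  have d: "?f x dvd prod_list (map ?f js)" if "x \<in> set js" for x js
    using that by (induction js) (auto intro: dvd_mult)
  have "?f (jobs I ! j) dvd D" if "j < n"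
    using d[of "jobs I ! j" "jobs I"] that
    by (simp add: D_def denom_def inst_def n_def num_jobs_def)
  then show "j < n \<Longrightarrow> snd (quotient_of (fst (jobs I ! j))) dvd D"
    "j < n \<Longrightarrow> snd (quotient_of (snd (jobs I ! j))) dvd D"
    by (auto dest: dvd_mult_left dvd_mult_right)
  show "snd (quotient_of (cache I)) dvd D"
    by (simp add: D_def denom_def inst_def)
qed

lemma A_eq: "j < n \<Longrightarrow> of_int (A j) = real m ^ 3 * D * load I j"
  using scale_eq[OF denom_dvd(1)] by (simp add: A_def load_def)

lemma A_pos: "j < n \<Longrightarrow> 0 < A j"
proof -
  assume j: "j < n"
  then have "0 < load I j"
    using wf by (simp add: wf_problem_def n_def)
  then have "0 < real m ^ 3 * D * load I j"
    using m D_pos by simp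
  then have "(0 :: real) < of_int (A j)"
    using A_eq[OF j] by simp
  then show ?thesis
    by simp
qed

lemma R_eq: "of_rat (R j) = demand I j"
  by (simp add: R_def demand_def)

lemma Q_R: "j < n \<Longrightarrow> Q (R j)"
proof -
  assume j: "j < n"
  then have "0 \<le> (of_rat (R j) :: real)"
    using wf by (simp add: R_eq wf_problem_def n_def)
  then show ?thesis
    using denom_dvd(2)[OF j] by (simp add: Q_def R_def)
qed

lemma Q_0: "Q 0"
  by (simp add: Q_def)

lemma scale_Q: "Q r \<Longrightarrow> of_int (scale D r) = of_int D * (of_rat r :: real)"
  by (simp add: Q_def scale_eq)

lemma items_eq: "items m inst = map (\<lambda>j. (A j, R j, [j])) [0..<n]"
  by (rule nth_equalityI)
    (auto simp: items_def inst_def n_def num_jobs_def nth_enumerate_eq A_def R_def D_def)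

lemma items_valid: "it \<in> set (items m inst) \<Longrightarrow> valid_item it \<and> 0 < fst it"
  by (auto simp: items_eq valid_item_def A_pos Q_R)

lemma concat_ids_items: "concat (map ids (items m inst)) = [0..<n]"
proof -
  have "concat (map ids (map (\<lambda>j. (A j, R j, [j])) js)) = js" for js
    by (induction js) auto
  then show ?thesis
    by (simp add: items_eq)
qed

lemma empty_cores_eq: "empty_cores inst = replicate N (0, 0, [])"
proof -
  have "length (filter (\<lambda>ij. fst ij < c) (List.enumerate 0 xs)) = min c (length xs)" for c and xs :: "'a list"
  proof -
    have "length (filter (\<lambda>ij. fst ij < c) (List.enumerate 0 xs)) =
        length (filter (\<lambda>i. i < c) (map fst (List.enumerate 0 xs)))"
      using arg_cong[OF filter_map[of "\<lambda>i. i < c" fst "List.enumerate 0 xs"], of length]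
      by (simp add: o_def)
    also have "\<dots> = card {i. i < length xs \<and> i < c}"
      by (simp add: length_filter_conv_card cong: conj_cong)
    also have "{i. i < length xs \<and> i < c} = {..<min c (length xs)}"
      by auto
    finally show ?thesis
      by simp
  qed
  then show ?thesis
    by (simp add: empty_cores_def inst_def map_replicate_const N_def n_def num_jobs_def)
qed

lemma units_eq: "units m inst = map (\<lambda>k. (int k + 1) * max_load inst) [0..<n * m]"
proof -
  have "length (concat (map (\<lambda>j. [0..<m]) js)) = length js * m" for js :: "'a list"
    by (induction js) auto
  then show ?thesis
    by (intro nth_equalityI) (auto simp: units_def inst_def n_def num_jobs_def nth_enumerate_eq)
qed

text \<open>Because of \<open>Q\<close> nothing is rounded in \<open>cost\<close>, so the integer
  test against the scaled cache is exact.\<close>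

lemma cost_eq:
  "(\<And>c. c \<in> set e \<Longrightarrow> Q (dem c)) \<Longrightarrow>
    of_int (cost D e) = of_int D * (\<Sum>i<length e. of_rat (dem (e ! i)) :: real)"
proof (induction e)
  case (Cons c e)
  then show ?case
    by (simp add: cost_def scale_Q sum.lessThan_Suc_shift algebra_simps del: sum.lessThan_Suc)
qed (simp add: cost_def)

abbreviation L :: nat where "L \<equiv> m ^ 2 + 3 * m + 3"

lemma max_load_ge: "j < n \<Longrightarrow> scale D (fst (jobs I ! j)) \<le> max_load inst"
  "0 \<le> max_load inst"
  "0 < n \<Longrightarrow> \<exists>j<n. max_load inst = scale D (fst (jobs I ! j))"
proof -
  let ?X = "set (map (\<lambda>j. scale D (fst j)) (jobs I))"
  have M: "max_load inst = Max (insert 0 ?X)"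
    by (simp only: max_load_def flip: Max.set_eq_fold) (simp add: inst_def D_def)
  have X: "?X = (\<lambda>j. scale D (fst (jobs I ! j))) ` {..<n}"
  proof -
    have "set (jobs I) = (!) (jobs I) ` {..<n}"
      by (auto simp: set_conv_nth n_def num_jobs_def)
    then show ?thesis
      by (simp add: image_image)
  qed
  show "j < n \<Longrightarrow> scale D (fst (jobs I ! j)) \<le> max_load inst"
    unfolding M X by (intro Max_ge) auto
  show "0 \<le> max_load inst"
    unfolding M by (intro Max_ge) auto
  assume "0 < n"
  have "max_load inst \<in> insert 0 ?X"
    unfolding M by (intro Max_in) auto
  moreover have "max_load inst \<noteq> 0"
  proof -
    have "0 < int m ^ 3 * scale D (fst (jobs I ! 0))"
      using A_pos[OF \<open>0 < n\<close>] by (simp add: A_def)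
    then have "0 < scale D (fst (jobs I ! 0))"
      using m by (simp add: zero_less_mult_iff)
    also have "\<dots> \<le> max_load inst"
      unfolding M X using \<open>0 < n\<close> by (intro Max_ge) auto
    finally show ?thesis by simp
  qed
  ultimately show "\<exists>j<n. max_load inst = scale D (fst (jobs I ! j))"
    unfolding X by auto
qed

text \<open>Levels overestimate loads, whatever the guess: an affordable entry is a solution in
  which every core has at most \<open>L\<close> units.\<close>

lemma solutions_sound:
  assumes "0 < u" "e \<in> set (solutions m inst u)"
  shows "is_solution I (partition_of (map dem e)) (assignment_of (map (core_of e) [0..<n]))"
    "length e \<le> cores I"
    "makespan I (assignment_of (map (core_of e) [0..<n])) * (real m ^ 3 * D) \<le> u * L"
proof -
  let ?p = "partition_of (map dem e)" and ?S = "assignment_of (map (core_of e) [0..<n])"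
  have e: "e \<in> set (fold (dp_step L D u) (pack (int m * u) (items m inst)) [replicate N (0, 0, [])])"
    and c: "cost D e \<le> scale D (cache I)"
  proof -
    have "snd (snd inst) = cache I"
      by (simp add: inst_def)
    then show "e \<in> set (fold (dp_step L D u) (pack (int m * u) (items m inst)) [replicate N (0, 0, [])])"
      "cost D e \<le> scale D (cache I)"
      using assms(2) by (simp_all add: solutions_def dp_def D_def flip: empty_cores_eq)
  qed
  note pv = pack_valid[where xs = "items m inst" and h = "int m * u", OF items_valid]
  have sound: "(\<forall>c\<in>set e. valid_core u [] c \<and> fst c \<le> L) \<and> length e = N \<and>
    mset (concat (map ids e)) = {#} + mset (concat (map ids (pack (int m * u) (items m inst))))"
    by (rule dp_sound[OF assms(1) e pv(1) pv(3)]) (auto simp: valid_core_def Q_0)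
  then have valid: "valid_core u [] c" "fst c \<le> L" if "c \<in> set e" for c
    using that by auto
  have len: "length e = N" and mset: "mset (concat (map ids e)) = mset [0..<n]"
    using sound pv(2) by (simp_all add: concat_ids_items)
  show "length e \<le> cores I"
    by (simp add: len N_def)
  have ids: "set (concat (map ids e)) = {..<n}"
    using mset_eq_setD[OF mset] by auto
  have dist: "distinct (concat (map ids e))"
    using mset_eq_imp_distinct_iff[OF mset] by simp
  have S: "?S j < N" "j \<in> set (ids (e ! ?S j))" if "j < n" for j
    using core_of[of j e] that ids len by (auto simp: assignment_of_def)
  have Q_e: "Q (dem c)" if "c \<in> set e" for c
    using valid(1)[OF that] by (simp add: valid_core_def)
  have "of_int D * (\<Sum>i<N. of_rat (dem (e ! i)) :: real) = of_int (cost D e)"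
    using cost_eq[OF Q_e] by (simp add: len)
  also have "\<dots> \<le> of_int (scale D (cache I))"
    using c by simp
  also have "\<dots> = of_int D * (of_rat (cache I) :: real)"
    by (rule scale_eq[OF denom_dvd(3)])
  finally have "(\<Sum>i<N. of_rat (dem (e ! i)) :: real) \<le> of_rat (cache I)"
    using D_pos by simp
  \<comment> \<open>Cores beyond the end of \<open>e\<close> get cache 0 from
    \<open>partition_of\<close>.\<close>
  moreover have "(\<Sum>i<cores I. ?p i) = (\<Sum>i<N. of_rat (dem (e ! i)))"
    by (rule sum.mono_neutral_cong_right) (auto simp: partition_of_def len N_def)
  moreover have "0 \<le> ?p i" for i
    using Q_e[of "e ! i"] by (auto simp: partition_of_def Q_def)
  moreover have "?S j < cores I \<and> demand I j \<le> ?p (?S j)" if "j < n" for j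
  proof -
    have "R j \<le> dem (e ! ?S j)"
      using valid(1)[of "e ! ?S j"] S[OF that] len by (simp add: valid_core_def)
    then have "demand I j \<le> of_rat (dem (e ! ?S j))"
      by (simp add: of_rat_less_eq flip: R_eq)
    then show ?thesis
      using S[OF that] len by (simp add: partition_of_def N_def)
  qed
  ultimately show "is_solution I ?p ?S"
    by (simp add: is_solution_def n_def)
  have core: "(\<Sum>j | j < n \<and> ?S j = i. load I j) * (real m ^ 3 * D) \<le> u * L" for i
  proof (cases "i < N")
    case True
    then have i: "e ! i \<in> set e"
      by (simp add: len)
    have "distinct (ids (e ! i))"
      using dist i by (auto simp: distinct_concat_iff)
    then have "(\<Sum>j\<in>set (ids (e ! i)). A j) \<le> u * int (fst (e ! i))"
      using valid(1)[OF i] by (simp add: valid_core_def sum.distinct_set_conv_list)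
    also have "\<dots> \<le> u * int L"
    proof (rule mult_left_mono)
      show "int (fst (e ! i)) \<le> int L"
        using valid(2)[OF i] by (simp only: of_nat_le_iff)
    qed (use assms(1) in simp)
    finally have *: "(\<Sum>j\<in>set (ids (e ! i)). A j) \<le> u * int L" .
    have "(\<Sum>j | j < n \<and> ?S j = i. A j) \<le> (\<Sum>j\<in>set (ids (e ! i)). A j)"
    proof (rule sum_mono2)
      show "0 \<le> A j" if "j \<in> set (ids (e ! i)) - {j. j < n \<and> ?S j = i}" for j
        using A_pos[of j] that ids i by (force intro: less_imp_le)
    qed (use S(2) in auto)
    with * have "real_of_int (\<Sum>j | j < n \<and> ?S j = i. A j) \<le> real_of_int (u * int L)"
      by linarith
    moreover have "real_of_int (\<Sum>j | j < n \<and> ?S j = i. A j) =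
        (\<Sum>j | j < n \<and> ?S j = i. load I j) * (real m ^ 3 * D)"
      by (simp add: A_eq sum_distrib_left sum_distrib_right mult.commute)
    ultimately show ?thesis
      by simp
  next
    case False
    then have "{j. j < n \<and> ?S j = i} = {}"
      using S(1) by auto
    then have "(\<Sum>j | j < n \<and> ?S j = i. load I j) = 0"
      by (simp only: sum.empty)
    then show ?thesis
      using assms(1) by simp
  qed
  have "makespan I ?S \<in> (\<lambda>i. \<Sum>j | j < n \<and> ?S j = i. load I j) ` {..<cores I}"
    unfolding makespan_def n_def using wf by (intro Max_in) (auto simp: wf_problem_def lessThan_empty_iff)
  then show "makespan I ?S * (real m ^ 3 * D) \<le> u * L"
    using core by auto
qed

text \<open>Packing turns the given assignment into one of the packed items, whose run stays within
  level \<open>L\<close> and within the caches \<open>p\<close>. The table holds an entry dominating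
  the final state, and its cost is at most the cost of \<open>p\<close>.\<close>

lemma solutions_complete:
  fixes p :: "nat \<Rightarrow> real"
  assumes "0 < u"
    and S: "\<And>j. j < n \<Longrightarrow> S j < N \<and> demand I j \<le> p (S j)"
    and p: "\<And>i i'. i \<le> i' \<Longrightarrow> i' < N \<Longrightarrow> p i' \<le> p i" "\<And>i. 0 \<le> p i"
      "(\<Sum>i<N. p i) \<le> of_rat (cache I)"
    and load: "\<And>i. (\<Sum>j | j < n \<and> S j = i. A j) \<le> int m ^ 2 * u"
  shows "solutions m inst u \<noteq> []"
proof -
  let ?h = "int m * u" and ?E = "replicate N (0, 0, []) :: core list"
  define ps where "ps = map (\<lambda>j. ((A j, R j, [j]), S j)) [0..<n]"
  have fst_ps: "map fst ps = items m inst"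
    by (simp add: ps_def items_eq o_def)
  have h: "0 < ?h"
    using assms(1) m by simp
  have core_ps: "core_load ps i \<le> int m ^ 2 * u" for i
  proof -
    have "core_load ps i = (\<Sum>j<n. if S j = i then A j else 0)"
      by (simp add: ps_def o_def interv_sum_list_conv_sum_set_nat atLeast0LessThan)
        (auto intro!: sum.cong)
    also have "\<dots> = (\<Sum>j | j < n \<and> S j = i. A j)"
      by (simp add: sum.If_cases lessThan_def Int_def)
    finally show ?thesis
      using load by simp
  qed
  have "\<exists>qs. map fst qs = pack ?h (map fst ps) \<and>
    (\<forall>(it, i)\<in>set qs. 0 \<le> fst it \<and> i < N \<and> of_rat (dem it) \<le> p i) \<and>
    (\<forall>i<N. core_load qs i \<le> core_load ps i + 2 * ?h) \<and>
    sum_list (map (\<lambda>(it, i). if fst it < ?h then ?h else 0) qs) \<le> ?h"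
    by (rule pack_assignment[OF _ p(1) h]) (use S in \<open>auto simp: ps_def A_pos R_eq\<close>)
  then obtain qs where qs: "map fst qs = pack ?h (items m inst)"
    "\<And>it i. (it, i) \<in> set qs \<Longrightarrow> 0 \<le> fst it \<and> i < N \<and> of_rat (dem it) \<le> p i"
    "\<And>i. i < N \<Longrightarrow> core_load qs i \<le> core_load ps i + 2 * ?h"
    "sum_list (map (\<lambda>(it, i). if fst it < ?h then ?h else 0) qs) \<le> ?h"
    unfolding fst_ps by blast
  define f where "f = place_all u qs ?E"
  have len: "length f = N"
    by (simp add: f_def)
  have level: "fst (f ! i) \<le> L" if i: "i < N" for i
  proof -
    let ?w = "\<lambda>(it, k). if k = i then weight u it else 0"
    \<comment> \<open>The second sum charges the light items of all cores, not just of core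
      \<open>i\<close>; even so it is at most one \<open>?h\<close> in total.\<close>
    have bound: "?h * int (sum_list (map ?w qs')) \<le> (int m + 1) * core_load qs' i +
        sum_list (map (\<lambda>(it, i). if fst it < ?h then ?h else 0) qs')" if "set qs' \<subseteq> set qs" for qs'
      using that
    proof (induction qs')
      case (Cons q qs')
      obtain it k where q: "q = (it, k)"
        by (cases q)
      have "0 \<le> fst it"
        using Cons.prems qs(2)[of it k] q by simp
      then have "?h * int (weight u it) \<le> (int m + 1) * fst it + (if fst it < ?h then ?h else 0)"
        using weight_bound[of "int m" u it] m assms(1) by simp
      moreover have "0 \<le> (if fst it < ?h then ?h else 0)"
        using h by simp
      ultimately show ?case
        using Cons by (auto simp: q algebra_simps)
    qed simp
    have "?h * int (fst (f ! i)) = ?h * int (sum_list (map ?w qs))"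
      using level_place_all[of i ?E u qs] i by (simp add: f_def)
    also have "\<dots> \<le> (int m + 1) * core_load qs i + ?h"
      using bound[of qs] qs(4) by simp
    also have "\<dots> \<le> (int m + 1) * (int m ^ 2 * u + 2 * ?h) + ?h"
      using qs(3)[OF i] core_ps[of i] by (intro add_right_mono mult_left_mono) auto
    finally have "int (fst (f ! i)) \<le> int m ^ 2 + 3 * int m + 3"
      using m assms(1) by (intro level_bound) auto
    also have "\<dots> = int L"
      by simp
    finally show ?thesis
      by (simp only: of_nat_le_iff)
  qed
  \<comment> \<open>The demand of a core is 0 or that of some item placed on it, and every such item
    fits into the cache \<open>p i\<close>.\<close>
  have dem: "Q (dem (f ! i)) \<and> of_rat (dem (f ! i)) \<le> p i" if i: "i < N" for i
    unfolding f_def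
  proof (rule demand_place_all)
    fix it
    assume it: "(it, i) \<in> set qs"
    then have "it \<in> set (pack ?h (items m inst))"
      unfolding qs(1)[symmetric] by force
    then have "Q (dem it)"
      using pack_valid(3)[OF items_valid] by (auto simp: valid_item_def)
    then show "Q (dem it) \<and> of_rat (dem it) \<le> p i"
      using qs(2)[OF it] by simp
  qed (use i Q_0 p(2) in simp_all)
  have "\<exists>e'\<in>set (fold (dp_step L D u) (map fst qs) [?E]). dominates D e' (place_all u qs ?E)"
  proof (rule dp_complete)
    show "\<forall>c\<in>set (place_all u qs ?E). fst c \<le> L"
      using level len unfolding f_def by (metis in_set_conv_nth)
  qed (use qs(2) in \<open>auto simp: dominates_def idle_zero_def\<close>)
  then obtain e where e: "e \<in> set (dp L D u (pack ?h (items m inst)) (empty_cores inst))" "cost D e \<le> cost D f"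
    by (auto simp: qs(1) dp_def empty_cores_eq dominates_def f_def)
  have Qf: "Q (dem c)" if "c \<in> set f" for c
    using dem that by (metis in_set_conv_nth len)
  have "real_of_int (cost D f) = of_int D * (\<Sum>i<N. of_rat (dem (f ! i)))"
    using cost_eq[OF Qf] by (simp add: len)
  also have "\<dots> \<le> of_int D * (\<Sum>i<N. p i)"
    using D_pos dem by (intro mult_left_mono sum_mono) auto
  also have "\<dots> \<le> of_int D * of_rat (cache I)"
    using D_pos p(3) by simp
  also have "\<dots> = of_int (scale D (cache I))"
    using scale_eq[OF denom_dvd(3)] by simp
  finally have "cost D f \<le> scale D (cache I)"
    by simp
  moreover have "snd (snd inst) = cache I"
    by (simp add: inst_def)
  ultimately have "e \<in> set (solutions m inst u)"
    using e by (simp add: solutions_def flip: D_def)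
  then show ?thesis
    by auto
qed

section \<open>Comparison with the optimum\<close>

lemma load_pos: "j < n \<Longrightarrow> 0 < load I j"
  using wf by (simp add: wf_problem_def n_def)

lemma optimal_solution:
  assumes "solvable I"
  obtains p S where "is_solution I p S" "makespan I S = opt_makespan I"
    "\<And>i. i < cores I \<Longrightarrow> (\<Sum>j | j < n \<and> S j = i. load I j) \<le> opt_makespan I"
proof -
  have "opt_makespan I \<in> makespans I"
    unfolding opt_makespan_def using assms by (intro Min_in) (simp_all add: finite_makespans makespans_nonempty)
  then obtain p S where pS: "is_solution I p S" "makespan I S = opt_makespan I"
    by (auto simp: makespans_def)
  moreover have "(\<Sum>j | j < n \<and> S j = i. load I j) \<le> opt_makespan I" if "i < cores I" for i
    unfolding pS(2)[symmetric] makespan_def n_def using that by (intro Max_ge) auto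
  ultimately show ?thesis
    by (rule that)
qed

lemma opt_makespan_nonneg: assumes "solvable I" shows "0 \<le> opt_makespan I"
proof -
  obtain p S where S: "\<And>i. i < cores I \<Longrightarrow> (\<Sum>j | j < n \<and> S j = i. load I j) \<le> opt_makespan I"
    by (rule optimal_solution[OF assms]) blast
  have "0 \<le> (\<Sum>j | j < n \<and> S j = 0. load I j)"
    using load_pos by (intro sum_nonneg) (auto intro: less_imp_le)
  then show ?thesis
    using S[of 0] wf by (simp add: wf_problem_def)
qed

lemma algorithm_correct:
  assumes "solvable I"
  shows "\<exists>ps ss. algorithm m inst = (ps, ss) \<and> length ps \<le> cores I \<and> length ss = num_jobs I \<and>
    is_solution I (partition_of ps) (assignment_of ss) \<and>
    makespan I (assignment_of ss) \<le> (1 + 13 / m) * opt_makespan I"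
proof -
  define M where "M = opt_makespan I"
  obtain p S where pS: "is_solution I p S" "makespan I S = M"
    and core_le: "\<And>i. i < cores I \<Longrightarrow> (\<Sum>j | j < n \<and> S j = i. load I j) \<le> M"
    unfolding M_def by (rule optimal_solution[OF assms]) blast
  have cores: "0 < cores I"
    using wf by (simp add: wf_problem_def)
  have M_nonneg: "0 \<le> M"
    unfolding M_def by (rule opt_makespan_nonneg[OF assms])
  show ?thesis
  proof (cases "n = 0")
    case True
    \<comment> \<open>Without jobs there are no guesses, and the default answer is a solution of
      makespan 0.\<close>
    then have "jobs I = []"
      by (simp add: n_def num_jobs_def)
    then have "algorithm m inst = ([], [])"
      by (simp add: algorithm_def units_def answer_def inst_def)
    moreover have "makespan I (assignment_of []) = 0"
      using True cores by (simp add: makespan_def n_def image_constant_conv lessThan_empty_iff)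
    ultimately show ?thesis
      using True cores wf M_nonneg
      by (auto simp: is_solution_def n_def partition_of_def wf_problem_def M_def)
  next
    case False
    define a where "a = max_load inst"
    define c where "c = real m ^ 3 * D"
    have c: "0 < c"
      using m D_pos by (simp add: c_def)
    have A_c: "of_int (A j) = c * load I j" if "j < n" for j
      using A_eq[OF that] by (simp add: c_def)
    obtain j0 where j0: "j0 < n" "a = scale D (fst (jobs I ! j0))"
      using max_load_ge(3) False unfolding a_def by auto
    have A_j0: "A j0 = int m ^ 3 * a"
      by (simp add: A_def j0(2))
    have a: "0 < a"
      using A_pos[OF j0(1)] m by (simp add: A_j0 zero_less_mult_iff)
    have sol: "\<And>j. j < n \<Longrightarrow> S j < cores I"
      using pS(1) by (auto simp: is_solution_def n_def)
    \<comment> \<open>The optimum in the scale of \<open>A\<close>. It lies between the largest load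
      and \<open>n\<close> times that load, which is the range of the guesses.\<close>
    define W where "W = c * M"
    have W_ge: "real m ^ 3 * a \<le> W"
    proof -
      have "load I j0 \<le> (\<Sum>j | j < n \<and> S j = S j0. load I j)"
        using j0(1) load_pos by (intro member_le_sum) (auto intro: less_imp_le)
      also have "\<dots> \<le> M"
        using core_le[OF sol[OF j0(1)]] .
      finally have "c * load I j0 \<le> W"
        using c by (simp add: W_def)
      then show ?thesis
        using A_c[OF j0(1)] by (simp add: A_j0)
    qed
    have W_le: "W \<le> real m ^ 3 * a * n"
    proof -
      have "M \<in> (\<lambda>i. \<Sum>j | j < n \<and> S j = i. load I j) ` {..<cores I}"
        unfolding pS(2)[symmetric] makespan_def n_def using cores
        by (intro Max_in) (auto simp: lessThan_empty_iff)
      then obtain i where "M = (\<Sum>j | j < n \<and> S j = i. load I j)"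
        by auto
      then have "W = (\<Sum>j | j < n \<and> S j = i. real_of_int (A j))"
        by (simp add: W_def sum_distrib_left A_c)
      also have "\<dots> \<le> (\<Sum>j<n. real_of_int (A j))"
        using A_pos by (intro sum_mono2) (auto intro: less_imp_le)
      also have "\<dots> \<le> (\<Sum>j<n. real m ^ 3 * a)"
        using max_load_ge(1) by (intro sum_mono) (simp add: A_def a_def mult_left_mono)
      finally show ?thesis
        by (simp add: mult.commute)
    qed
    \<comment> \<open>The distance of consecutive guesses \<open>m^2 * u\<close>: one
      \<open>m\<close>-th of the largest load, hence at most \<open>W / m\<close>.\<close>
    define b where "b = real m ^ 2 * a"
    have b: "0 < b"
      using m a by (simp add: b_def)
    have Wb: "real m * b \<le> W" "W \<le> real (n * m) * b"
      using W_ge W_le by (simp_all add: b_def power3_eq_cube power2_eq_square algebra_simps)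
    \<comment> \<open>Index of the smallest guess that is at least \<open>W\<close>; the
      \<open>- 1\<close> is there because index 0 stands for the multiplier 1.\<close>
    define k where "k = nat (\<lceil>W / b\<rceil> - 1)"
    have "0 < W / b"
      using Wb(1) b m by (simp add: zero_less_divide_iff) (smt (verit) mult_pos_pos of_nat_0_less_iff)
    then have k: "int k + 1 = \<lceil>W / b\<rceil>"
      by (simp add: k_def)
    have "W / b \<le> real (n * m)"
      using Wb(2) b by (simp add: divide_le_eq)
    then have "\<lceil>W / b\<rceil> \<le> int (n * m)"
      by (simp add: ceiling_le_iff)
    then have k_lt: "k < n * m"
      using k by linarith
    define u where "u = (int k + 1) * a"
    have u: "0 < u"
      using a by (simp add: u_def)
    have real_u: "real m ^ 2 * u = of_int \<lceil>W / b\<rceil> * b"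
    proof -
      have "of_int \<lceil>W / b\<rceil> = real k + 1"
        using k by linarith
      then show ?thesis
        by (simp add: u_def b_def)
    qed
    have u_ge: "W \<le> real m ^ 2 * u"
      unfolding real_u using b by (simp add: pos_divide_le_eq[symmetric])
    have u_le: "real m ^ 2 * u \<le> W + b"
    proof -
      have "of_int \<lceil>W / b\<rceil> \<le> W / b + 1"
        by linarith
      then have "of_int \<lceil>W / b\<rceil> * b \<le> (W / b + 1) * b"
        using b by (intro mult_right_mono) auto
      then show ?thesis
        using b real_u by (simp add: algebra_simps)
    qed
    obtain p' S' where p': "\<And>j. j < num_jobs I \<Longrightarrow> S' j < min (cores I) (num_jobs I) \<and> demand I j \<le> p' (S' j)"
      "\<And>i i'. i \<le> i' \<Longrightarrow> i' < min (cores I) (num_jobs I) \<Longrightarrow> p' i' \<le> p' i" "\<And>i. 0 \<le> p' i"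
      "(\<Sum>i<min (cores I) (num_jobs I). p' i) \<le> of_rat (cache I)"
      "\<And>i. (\<Sum>j | j < num_jobs I \<and> S' j = i. load I j) \<le> M"
    proof (rule normalize_solution[OF pS(1) M_nonneg])
      show "(\<Sum>j | j < num_jobs I \<and> S j = i. load I j) \<le> M" if "i < cores I" for i
        using core_le[OF that] by (simp add: n_def)
    qed (rule that)
    have "solutions m inst u \<noteq> []"
    proof (rule solutions_complete[OF u])
      show "(\<Sum>j | j < n \<and> S' j = i. A j) \<le> int m ^ 2 * u" for i
      proof -
        have "real_of_int (\<Sum>j | j < n \<and> S' j = i. A j) = c * (\<Sum>j | j < n \<and> S' j = i. load I j)"
          by (simp add: sum_distrib_left A_c)
        also have "\<dots> \<le> W"
          using p'(5)[of i] c by (simp add: W_def n_def)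
        also have "\<dots> \<le> real_of_int (int m ^ 2 * u)"
          using u_ge by simp
        finally show ?thesis
          by linarith
      qed
    qed (use p' in \<open>auto simp: N_def n_def\<close>)
    \<comment> \<open>The answer may stem from an earlier guess \<open>v\<close> than
      \<open>u\<close>; as \<open>v \<le> u\<close>, its makespan bound is only smaller.\<close>
    then obtain i where i: "i \<le> k"
      "hd (concat (map (solutions m inst) (units m inst))) \<in> set (solutions m inst ((int i + 1) * a))"
      using hd_concat_map[of k "units m inst" "solutions m inst"] k_lt
      by (auto simp: units_eq u_def a_def)
    define e where "e = hd (concat (map (solutions m inst) (units m inst)))"
    define v where "v = (int i + 1) * a"
    have "v > 0" "v \<le> u"
      using i(1) a by (auto simp: v_def u_def)
    have e: "e \<in> set (solutions m inst v)"
      using i(2) by (simp add: e_def v_def)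
    have "u \<in> set (units m inst)"
      using k_lt by (auto simp: units_eq u_def a_def)
    then have "concat (map (solutions m inst) (units m inst)) \<noteq> []"
      using \<open>solutions m inst u \<noteq> []\<close> by auto
    moreover have "map (\<lambda>ij. core_of e (fst ij)) (List.enumerate 0 (fst inst)) = map (core_of e) [0..<n]"
      by (rule nth_equalityI) (auto simp: nth_enumerate_eq inst_def n_def num_jobs_def)
    ultimately have alg: "algorithm m inst = (map dem e, map (core_of e) [0..<n])"
      by (simp only: algorithm_def answer_def if_False e_def)
    note s = solutions_sound[OF \<open>v > 0\<close> e]
    let ?ms = "makespan I (assignment_of (map (core_of e) [0..<n]))"
    have "?ms * c \<le> real_of_int v * real L"
      using s(3) by (simp add: c_def)
    also have "\<dots> \<le> real_of_int u * real L"
      using \<open>v \<le> u\<close> by (intro mult_right_mono) auto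
    finally have "real m ^ 3 * (?ms * c) \<le> real m * (real m ^ 2 * u) * L"
      using m by (simp add: power3_eq_cube power2_eq_square mult.assoc)
    also have "\<dots> \<le> (real m * (W + b)) * L"
      using u_le m by (intro mult_right_mono mult_left_mono) auto
    \<comment> \<open>Overshooting the optimum by one step \<open>b\<close> costs a factor
      \<open>(m + 1) / m\<close>, since \<open>m * b \<le> W\<close>.\<close>
    also have "\<dots> \<le> ((real m + 1) * W) * L"
      using Wb(1) by (intro mult_right_mono) (auto simp: algebra_simps)
    also have "\<dots> = ((real m + 1) * L) * W"
      by simp
    also have "\<dots> \<le> (real m ^ 3 * (1 + 13 / m)) * W"
    proof (rule mult_right_mono)
      have "1 \<le> real m"
        using m by simp
      then have "real m \<le> real m ^ 2" "1 \<le> real m ^ 2"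
        by (rule self_le_power one_le_power; simp)+
      moreover have "real m ^ 3 * (1 + 13 / m) = real m ^ 3 + 13 * real m ^ 2"
        using m by (simp add: field_simps power2_eq_square power3_eq_cube)
      moreover have "(real m + 1) * real L = real m ^ 3 + 4 * real m ^ 2 + 6 * real m + 3"
        by (simp add: algebra_simps power2_eq_square power3_eq_cube)
      \<comment> \<open>With \<open>m\<close> and 1 both at most \<open>m^2\<close>, the lower terms
        add up to \<open>4 + 6 + 3 = 13\<close> times \<open>m^2\<close>.\<close>
      ultimately show "(real m + 1) * real L \<le> real m ^ 3 * (1 + 13 / m)"
        by linarith
      show "0 \<le> W"
        using M_nonneg c by (simp add: W_def)
    qed
    finally have "real m ^ 3 * (?ms * c) \<le> real m ^ 3 * ((1 + 13 / m) * M * c)"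
      unfolding W_def by (simp only: ac_simps)
    moreover have "0 < real m ^ 3"
      using m by simp
    ultimately have "?ms * c \<le> (1 + 13 / m) * M * c"
      by (rule mult_left_le_imp_le)
    then have "?ms \<le> (1 + 13 / m) * M"
      using c by (rule mult_right_le_imp_le)
    then show ?thesis
      using s alg by (simp add: M_def n_def)
  qed
qed

end

section \<open>From the calculus to a program\<close>

text \<open>A run starts with function 0, so the main expression is put in front of the relocated
  program; the initial call adds \<open>2\<close> plus the input size to the cost.\<close>

lemma ptime_program:
  assumes "ptime f"
  obtains P q where "\<And>x. \<exists>t. runs P (enc x) (enc (f x)) t \<and> t \<le> poly q (sz x)"
proof -
  obtain P e q where c: "computes P e q f"
    by (rule ptimeE[OF assms])
  define P' where "P' = (shift 1 e) # map (shift 1) P"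
  have "\<exists>t. runs P' (enc x) (enc (f x)) t \<and> t \<le> poly ([:2:] + [:0, 1:] + q) (sz x)" for x
  proof -
    have "computes ([shift 1 e] @ map (shift (length [shift 1 e])) P) (shift (length [shift 1 e]) e) q f"
      by (rule computes_shift[OF c])
    then have "computes P' (shift 1 e) q f"
      by (simp add: P'_def)
    from computesD[OF this] obtain t
      where t: "eval P' [enc x] (P' ! 0) (enc (f x)) t" "t \<le> poly q (sz x)"
      by (auto simp: evalb_def P'_def)
    have "evals P' [enc x] [Var 0] [[enc x] ! 0] (1 + vsize ([enc x] ! 0) + 0)"
      by (intro Args_Cons Args_Nil eval_evals.Var) simp
    then have "evals P' [enc x] [Var 0] [enc x] (1 + sz x + 0)"
      by simp
    from eval_evals.Call[OF _ this t(1)] have "runs P' (enc x) (enc (f x)) (1 + (1 + sz x + 0) + t)"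
      by (simp add: runs_def P'_def)
    then show ?thesis
      using t(2) by (intro exI conjI) (assumption, simp)
  qed
  then show ?thesis
    by (rule that)
qed

lemma encode_inst: "encode_problem I = enc (jobs I, cores I, cache I)"
proof -
  have "(\<lambda>(a, x). Node (encode_rat a) (encode_rat x)) = enc"
    by (auto simp: enc_rat_def fun_eq_iff)
  then show ?thesis
    by (simp add: encode_problem_def enc_list_def enc_nat_def enc_rat_def)
qed

lemma encode_solution_eq: "encode_solution ps ss = enc (ps, ss)"
proof -
  have "(\<lambda>i. Num (int i)) = enc" "encode_rat = enc"
    by (simp_all add: enc_nat_def enc_rat_def fun_eq_iff)
  then show ?thesis
    by (simp add: encode_solution_def enc_list_def)
qed

theorem theorem10:
  fixes \<epsilon> :: real
  assumes "\<epsilon> > 0"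
  shows "\<exists>P. poly_time_on P (encode_problem ` {I. wf_problem I \<and> correlative I}) \<and>
    (\<forall>I. wf_problem I \<longrightarrow> correlative I \<longrightarrow> solvable I \<longrightarrow>
      (\<exists>ps ss. returns P (encode_problem I) (encode_solution ps ss) \<and>
        length ps \<le> cores I \<and> length ss = num_jobs I \<and>
        is_solution I (partition_of ps) (assignment_of ss) \<and>
        makespan I (assignment_of ss) \<le> (1 + \<epsilon>) * opt_makespan I))"
proof -
  obtain m :: nat where m: "13 / \<epsilon> < m"
    using reals_Archimedean2 by blast
  then have "0 < m"
    using assms by (metis divide_pos_pos less_trans of_nat_0_less_iff zero_less_numeral)
  have m_eps: "13 / m \<le> \<epsilon>"
    using m assms \<open>0 < m\<close> by (simp add: field_simps)
  obtain P q where P: "\<And>x. \<exists>t. runs P (enc x) (enc (algorithm m x)) t \<and> t \<le> poly q (sz x)"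
    by (rule ptime_program[OF ptime_algorithm[of m]]) blast
  \<comment> \<open>The bound holds for every triple of the instance type, so solvability plays no
    part in the running time.\<close>
  have "poly_time_on P (encode_problem ` {I. wf_problem I \<and> correlative I})"
    using P unfolding poly_time_on_def encode_inst by blast
  moreover have "\<exists>ps ss. returns P (encode_problem I) (encode_solution ps ss) \<and>
      length ps \<le> cores I \<and> length ss = num_jobs I \<and>
      is_solution I (partition_of ps) (assignment_of ss) \<and>
      makespan I (assignment_of ss) \<le> (1 + \<epsilon>) * opt_makespan I"
    if wf: "wf_problem I" and solvable: "solvable I" for I
  proof -
    interpret approximation I m
      by unfold_locales (use wf \<open>0 < m\<close> in auto)
    obtain ps ss where s: "algorithm m inst = (ps, ss)" "length ps \<le> cores I" "length ss = num_jobs I"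
      "is_solution I (partition_of ps) (assignment_of ss)"
      "makespan I (assignment_of ss) \<le> (1 + 13 / m) * opt_makespan I"
      using algorithm_correct[OF solvable] by blast
    have "(1 + 13 / m) * opt_makespan I \<le> (1 + \<epsilon>) * opt_makespan I"
      using m_eps opt_makespan_nonneg[OF solvable] by (intro mult_right_mono) auto
    moreover have "returns P (encode_problem I) (encode_solution ps ss)"
      using P[of inst] s(1) unfolding returns_def encode_inst encode_solution_eq inst_def by auto
    ultimately show ?thesis
      using s by (metis order_trans)
  qed
  ultimately show ?thesis
    by blast
qed

end
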